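(* Let $n\ge 1$, let $a,b\in D_\infty$, where $D_\infty$ carries the Scott topology, and let $p$ and $q$ be parallel $n$-paths in $D_\infty$ based on $a,b$. Then $p=_h q$.
   Context: **$n$-paths.** Let $D$ be a topological space. For a map $p:[0,1]^n\to D$ and constants $a_i$, $p[t_{r_1}=a_1,\dots,t_{r_k}=a_k]$ denotes the map of the remaining $n-k$ variables obtained by fixing $t_{r_i}=a_i$. For $n\ge1$, an $n$-path based on $a,b\in D$ is a continuous map $p:[0,1]^n\to D$ with $p(t_1,\dots,t_{n-1},0)=a$ and $p(t_1,\dots,t_{n-1},1)=b$ for all $t_1,\dots,t_{n-1}\in[0,1]$. For two $n$-paths $p_1,p_2$ based on $a,b$, write $p_1=_h p_2$ if there is an $(n+1)$-path $P$ based on $a,b$ from $p_1$ to $p_2$, i.e. with $P[t_1=0]=p_1$ and $P[t_1=1]=p_2$. Two $n$-paths $p,q$ based on $a,b$ are parallel if for each $r=1,\dots,n-1$: $p[t_1=0,\dots,t_r=0]=q[t_1=0,\dots,t_r=0]$ and $p[t_1=1,\dots,t_r=1]=q[t_1=1,\dots,t_r=1]$. **Scott's $D_\infty$.** A c.p.o. is a partially ordered set with a least element in which every (non-empty) directed subset has a least upper bound. The Scott topology on a c.p.o. has as open sets the upward closed sets $A$ such that $\bigsqcup X\in A$ implies $X\cap A\neq\emptyset$ for every directed $X$. $[D\to D']$ is the c.p.o. of functions preserving least upper bounds of directed sets, ordered pointwise. $\mathbb{N}^+=\mathbb{N}\cup\{\perp\}$ with $a\sqsubseteq b$ iff $a=\perp$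 or $a=b$. Put $D_0=\mathbb{N}^+$, $D_{n+1}=[D_n\to D_n]$, and let $\perp_n$ be the least element of $D_n$. Define $\phi_n\in[D_n\to D_{n+1}]$ and $\psi_n\in[D_{n+1}\to D_n]$ by: $\phi_0(d)$ is the constant function with value $d$; $\psi_0(g)=g(\perp_0)$; $\phi_{n+1}(d)=\phi_n\circ d\circ\psi_n$; $\psi_{n+1}(g)=\psi_n\circ g\circ\phi_n$. $D_\infty$ is the c.p.o. of all sequences $d=\langle d_0,d_1,\dots\rangle$ with $d_n\in D_n$ and $\psi_n(d_{n+1})=d_n$ for all $n\ge 0$, ordered componentwise. *)

theory Defs
  imports "HOL-Analysis.Analysis" "HOL-Algebra.Lattice"
begin

section \<open>C.p.o.s and the Scott topology\<close>

definition directed :: "('a, 'c) gorder_scheme \<Rightarrow> 'a set \<Rightarrow> bool" where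
  "directed L X \<longleftrightarrow> X \<subseteq> carrier L \<and> X \<noteq> {} \<and>
     (\<forall>x\<in>X. \<forall>y\<in>X. \<exists>z\<in>X. x \<sqsubseteq>\<^bsub>L\<^esub> z \<and> y \<sqsubseteq>\<^bsub>L\<^esub> z)"

definition cpo :: "('a, 'c) gorder_scheme \<Rightarrow> bool" where
  "cpo L \<longleftrightarrow> partial_order L \<and> (\<exists>x. least L x (carrier L)) \<and>
     (\<forall>X. directed L X \<longrightarrow> (\<exists>x. is_lub L x X))"

definition scott_open :: "('a, 'c) gorder_scheme \<Rightarrow> 'a set \<Rightarrow> bool" where
  "scott_open L A \<longleftrightarrow> A \<subseteq> carrier L \<and>
     (\<forall>x\<in>A. \<forall>y\<in>carrier L. x \<sqsubseteq>\<^bsub>L\<^esub> y \<longrightarrow> y \<in> A) \<and>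
     (\<forall>X x. directed L X \<longrightarrow> is_lub L x X \<longrightarrow> x \<in> A \<longrightarrow> X \<inter> A \<noteq> {})"

definition scott_topology :: "('a, 'c) gorder_scheme \<Rightarrow> 'a topology" where
  "scott_topology L = topology (scott_open L)"

lemma scott_openD:
  assumes "scott_open L A"
  shows "A \<subseteq> carrier L"
    and "x \<in> A \<Longrightarrow> y \<in> carrier L \<Longrightarrow> x \<sqsubseteq>\<^bsub>L\<^esub> y \<Longrightarrow> y \<in> A"
    and "directed L X \<Longrightarrow> is_lub L x X \<Longrightarrow> x \<in> A \<Longrightarrow> \<exists>z. z \<in> X \<and> z \<in> A"
  using assms unfolding scott_open_def by (simp, metis, metis disjoint_iff)

lemma istopology_scott_open: "istopology (scott_open L)"
  unfolding istopology_def
proof (intro conjI allI impI)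
  fix S T assume S: "scott_open L S" and T: "scott_open L T"
  have "X \<inter> (S \<inter> T) \<noteq> {}"
    if X: "directed L X" and x: "is_lub L x X" "x \<in> S \<inter> T" for X x
  proof -
    obtain s where s: "s \<in> X" "s \<in> S"
      using scott_openD(3)[OF S X x(1)] x(2) by auto
    obtain t where t: "t \<in> X" "t \<in> T"
      using scott_openD(3)[OF T X x(1)] x(2) by auto
    obtain z where z: "z \<in> X" "s \<sqsubseteq>\<^bsub>L\<^esub> z" "t \<sqsubseteq>\<^bsub>L\<^esub> z" "z \<in> carrier L"
      using X s(1) t(1) unfolding directed_def by (meson subsetD)
    have "z \<in> S" "z \<in> T"
      using scott_openD(2)[OF S s(2) z(4,2)] scott_openD(2)[OF T t(2) z(4,3)] by auto
    then show ?thesis using z(1) by auto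
  qed
  moreover have "\<forall>x\<in>S \<inter> T. \<forall>y\<in>carrier L. x \<sqsubseteq>\<^bsub>L\<^esub> y \<longrightarrow> y \<in> S \<inter> T"
    using scott_openD(2)[OF S] scott_openD(2)[OF T] by auto
  moreover have "S \<inter> T \<subseteq> carrier L"
    using scott_openD(1)[OF S] by (simp add: le_infI1)
  ultimately show "scott_open L (S \<inter> T)"
    unfolding scott_open_def by (intro conjI allI impI)
next
  fix K assume K: "\<forall>S\<in>K. scott_open L S"
  have "X \<inter> \<Union>K \<noteq> {}" if X: "directed L X" "is_lub L x X" and x: "x \<in> \<Union>K" for X x
  proof -
    obtain S where "S \<in> K" "x \<in> S" using x by auto
    then show ?thesis using scott_openD(3)[of L S, OF _ X] K by auto
  qed
  moreover have "\<forall>x\<in>\<Union>K. \<forall>y\<in>carrier L. x \<sqsubseteq>\<^bsub>L\<^esub> y \<longrightarrow> y \<in> \<Union>K"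
    using K scott_openD(2) by (metis Union_iff)
  moreover have "\<Union>K \<subseteq> carrier L"
    using K by (intro Union_least) (simp add: scott_open_def)
  ultimately show "scott_open L (\<Union>K)"
    unfolding scott_open_def by (intro conjI allI impI)
qed

lemma openin_scott_topology [simp]: "openin (scott_topology L) A \<longleftrightarrow> scott_open L A"
  by (simp add: scott_topology_def istopology_scott_open)

lemma topspace_scott_topology [simp]: "topspace (scott_topology L) = carrier L"
proof -
  have "X \<inter> carrier L \<noteq> {}" if "directed L X" for X
    using that unfolding directed_def by auto
  then have "scott_open L (carrier L)"
    unfolding scott_open_def by auto
  then show ?thesis
    unfolding topspace_def openin_scott_topology by (intro equalityI Union_least Union_upper)
      (simp_all add: scott_open_def)
qed

text \<open>The function space \<open>[L \<rightarrow> M]\<close>. Its elements are extensional (\<^const>\<open>undefined\<close> off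
  \<open>carrier L\<close>), so that equality in HOL is equality as maps on \<open>carrier L\<close>.\<close>

definition fun_cpo :: "('a, 'c) gorder_scheme \<Rightarrow> ('b, 'd) gorder_scheme \<Rightarrow> ('a \<Rightarrow> 'b) gorder" where
  "fun_cpo L M =
     \<lparr>carrier = {f \<in> carrier L \<rightarrow>\<^sub>E carrier M.
                  \<forall>X x. directed L X \<longrightarrow> is_lub L x X \<longrightarrow> is_lub M (f x) (f ` X)},
      eq = (=),
      le = (\<lambda>f g. \<forall>x\<in>carrier L. f x \<sqsubseteq>\<^bsub>M\<^esub> g x)\<rparr>"

definition Nplus :: "nat option gorder" where
  "Nplus = \<lparr>carrier = UNIV, eq = (=), le = (\<lambda>a b. a = None \<or> a = b)\<rparr>"


section \<open>The c.p.o.s $D_n$\<close>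

text \<open>HOL has no type containing the iterated function spaces literally, so each of them is replaced
  by an isomorphic copy whose elements are sets of natural numbers. The copy is taken along an
  arbitrary injection; the lemma \<open>inj_on_code_D\<close> below shows that the required injections exist,
  i.e. that no $D_n$ has more than continuum many elements.\<close>

type_synonym code = "nat set"

definition code :: "('a, 'c) gorder_scheme \<Rightarrow> 'a \<Rightarrow> code" where
  "code L = (SOME c. inj_on c (carrier L))"

definition decode :: "('a, 'c) gorder_scheme \<Rightarrow> code \<Rightarrow> 'a" where
  "decode L = inv_into (carrier L) (code L)"

definition coded :: "('a, 'c) gorder_scheme \<Rightarrow> code gorder" where
  "coded L = \<lparr>carrier = code L ` carrier L, eq = (=),
              le = (\<lambda>u v. decode L u \<sqsubseteq>\<^bsub>L\<^esub> decode L v)\<rparr>"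

primrec D :: "nat \<Rightarrow> code gorder" where
  "D 0 = coded Nplus"
| "D (Suc n) = coded (fun_cpo (D n) (D n))"

subsection \<open>Existence of the codes\<close>

lemma is_lub_iff:
  assumes "X \<subseteq> carrier L"
  shows "is_lub L x X \<longleftrightarrow> x \<in> carrier L \<and> (\<forall>y\<in>X. y \<sqsubseteq>\<^bsub>L\<^esub> x) \<and>
           (\<forall>u\<in>carrier L. (\<forall>y\<in>X. y \<sqsubseteq>\<^bsub>L\<^esub> u) \<longrightarrow> x \<sqsubseteq>\<^bsub>L\<^esub> u)"
  using assms unfolding least_def Upper_def by blast

lemma is_lubI:
  assumes "X \<subseteq> carrier L" "x \<in> carrier L" "\<And>y. y \<in> X \<Longrightarrow> y \<sqsubseteq>\<^bsub>L\<^esub> x"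
    and "\<And>u. u \<in> carrier L \<Longrightarrow> (\<And>y. y \<in> X \<Longrightarrow> y \<sqsubseteq>\<^bsub>L\<^esub> u) \<Longrightarrow> x \<sqsubseteq>\<^bsub>L\<^esub> u"
  shows "is_lub L x X"
  using assms by (simp add: is_lub_iff)

lemma is_lubD:
  assumes "is_lub L x X" "X \<subseteq> carrier L"
  shows "x \<in> carrier L"
    and "y \<in> X \<Longrightarrow> y \<sqsubseteq>\<^bsub>L\<^esub> x"
    and "u \<in> carrier L \<Longrightarrow> (\<And>y. y \<in> X \<Longrightarrow> y \<sqsubseteq>\<^bsub>L\<^esub> u) \<Longrightarrow> x \<sqsubseteq>\<^bsub>L\<^esub> u"
  using assms by (simp_all add: is_lub_iff)

lemma cpoD:
  assumes "cpo L"
  shows "x \<in> carrier L \<Longrightarrow> x \<sqsubseteq>\<^bsub>L\<^esub> x"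
    and "x \<sqsubseteq>\<^bsub>L\<^esub> y \<Longrightarrow> y \<sqsubseteq>\<^bsub>L\<^esub> z \<Longrightarrow> x \<in> carrier L \<Longrightarrow> y \<in> carrier L \<Longrightarrow> z \<in> carrier L \<Longrightarrow> x \<sqsubseteq>\<^bsub>L\<^esub> z"
    and "x \<sqsubseteq>\<^bsub>L\<^esub> y \<Longrightarrow> y \<sqsubseteq>\<^bsub>L\<^esub> x \<Longrightarrow> x \<in> carrier L \<Longrightarrow> y \<in> carrier L \<Longrightarrow> x = y"
    and "directed L X \<Longrightarrow> \<exists>x. is_lub L x X"
    and "\<exists>x. least L x (carrier L)"
proof -
  interpret partial_order L using assms by (simp add: cpo_def)
  show "x \<in> carrier L \<Longrightarrow> x \<sqsubseteq>\<^bsub>L\<^esub> x" by simp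
  show "x \<sqsubseteq>\<^bsub>L\<^esub> y \<Longrightarrow> y \<sqsubseteq>\<^bsub>L\<^esub> z \<Longrightarrow> x \<in> carrier L \<Longrightarrow> y \<in> carrier L \<Longrightarrow> z \<in> carrier L \<Longrightarrow> x \<sqsubseteq>\<^bsub>L\<^esub> z"
    by (rule le_trans)
  show "x \<sqsubseteq>\<^bsub>L\<^esub> y \<Longrightarrow> y \<sqsubseteq>\<^bsub>L\<^esub> x \<Longrightarrow> x \<in> carrier L \<Longrightarrow> y \<in> carrier L \<Longrightarrow> x = y"
    by (rule le_antisym)
  show "directed L X \<Longrightarrow> \<exists>x. is_lub L x X" "\<exists>x. least L x (carrier L)"
    using assms by (simp_all add: cpo_def)
qed

lemma cpoI:
  assumes "eq L = (=)"
    and "\<And>x. x \<in> carrier L \<Longrightarrow> x \<sqsubseteq>\<^bsub>L\<^esub> x"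
    and "\<And>x y z. x \<sqsubseteq>\<^bsub>L\<^esub> y \<Longrightarrow> y \<sqsubseteq>\<^bsub>L\<^esub> z \<Longrightarrow> x \<in> carrier L \<Longrightarrow> y \<in> carrier L \<Longrightarrow> z \<in> carrier L \<Longrightarrow> x \<sqsubseteq>\<^bsub>L\<^esub> z"
    and "\<And>x y. x \<sqsubseteq>\<^bsub>L\<^esub> y \<Longrightarrow> y \<sqsubseteq>\<^bsub>L\<^esub> x \<Longrightarrow> x \<in> carrier L \<Longrightarrow> y \<in> carrier L \<Longrightarrow> x = y"
    and "\<And>X. directed L X \<Longrightarrow> \<exists>x. is_lub L x X"
    and "b \<in> carrier L" "\<And>x. x \<in> carrier L \<Longrightarrow> b \<sqsubseteq>\<^bsub>L\<^esub> x"
  shows "cpo L"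
  unfolding cpo_def
proof (intro conjI allI impI)
  show "partial_order L"
    by unfold_locales (use assms(1-4) in auto)
  show "\<exists>x. least L x (carrier L)"
    using assms(6,7) unfolding least_def by auto
qed (rule assms(5))

lemma fun_cpo_simps:
  "eq (fun_cpo L M) = (=)"
  "f \<sqsubseteq>\<^bsub>fun_cpo L M\<^esub> g \<longleftrightarrow> (\<forall>x\<in>carrier L. f x \<sqsubseteq>\<^bsub>M\<^esub> g x)"
  by (simp_all add: fun_cpo_def)

lemma fun_cpoD:
  assumes "f \<in> carrier (fun_cpo L M)"
  shows "f \<in> carrier L \<rightarrow>\<^sub>E carrier M"
    and "x \<in> carrier L \<Longrightarrow> f x \<in> carrier M"
    and "directed L X \<Longrightarrow> is_lub L x X \<Longrightarrow> is_lub M (f x) (f ` X)"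
  using assms by (auto simp: fun_cpo_def)

lemma fun_cpo_mono:
  assumes "cpo L" and f: "f \<in> carrier (fun_cpo L M)"
    and xy: "x \<in> carrier L" "y \<in> carrier L" "x \<sqsubseteq>\<^bsub>L\<^esub> y"
  shows "f x \<sqsubseteq>\<^bsub>M\<^esub> f y"
proof -
  have "directed L {x, y}" "is_lub L y {x, y}"
    using cpoD(1)[OF \<open>cpo L\<close>] xy by (auto simp: directed_def is_lub_iff)
  from fun_cpoD(3)[OF f this] show ?thesis
    using xy fun_cpoD(2)[OF f] by (simp add: is_lub_iff)
qed

lemma directed_image:
  assumes X: "directed L X" and f: "\<And>x. x \<in> X \<Longrightarrow> f x \<in> carrier M"
    and mono: "\<And>x y. x \<in> X \<Longrightarrow> y \<in> X \<Longrightarrow> x \<sqsubseteq>\<^bsub>L\<^esub> y \<Longrightarrow> f x \<sqsubseteq>\<^bsub>M\<^esub> f y"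
  shows "directed M (f ` X)"
  unfolding directed_def
proof (intro conjI ballI)
  show "f ` X \<subseteq> carrier M" "f ` X \<noteq> {}"
    using X f by (auto simp: directed_def)
  fix u v assume "u \<in> f ` X" "v \<in> f ` X"
  then obtain x y where "x \<in> X" "u = f x" "y \<in> X" "v = f y" by auto
  moreover from this obtain z where "z \<in> X" "x \<sqsubseteq>\<^bsub>L\<^esub> z" "y \<sqsubseteq>\<^bsub>L\<^esub> z"
    using X unfolding directed_def by meson
  ultimately show "\<exists>w\<in>f ` X. u \<sqsubseteq>\<^bsub>M\<^esub> w \<and> v \<sqsubseteq>\<^bsub>M\<^esub> w"
    using mono by auto
qed

lemma fun_cpo_lub:
  assumes L: "cpo L" and M: "cpo M" and F: "directed (fun_cpo L M) F"
  obtains h where "is_lub (fun_cpo L M) h F"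
    and "\<And>x. x \<in> carrier L \<Longrightarrow> is_lub M (h x) ((\<lambda>f. f x) ` F)"
proof -
  have FC: "F \<subseteq> carrier (fun_cpo L M)" and Fne: "F \<noteq> {}"
    using F by (auto simp: directed_def)
  have FM: "f x \<in> carrier M" if "f \<in> F" "x \<in> carrier L" for f x
    using fun_cpoD(2) FC that by (metis subsetD)
  have img: "(\<lambda>f. f x) ` F \<subseteq> carrier M" if "x \<in> carrier L" for x
    using FM that by auto
  have "\<exists>y. is_lub M y ((\<lambda>f. f x) ` F)" if x: "x \<in> carrier L" for x
    by (rule cpoD(4)[OF M], rule directed_image[OF F])
      (use x FM in \<open>auto simp: fun_cpo_simps\<close>)
  then obtain h0 where h0: "\<And>x. x \<in> carrier L \<Longrightarrow> is_lub M (h0 x) ((\<lambda>f. f x) ` F)"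
    by metis
  define h where "h = restrict h0 (carrier L)"
  have h: "is_lub M (h x) ((\<lambda>f. f x) ` F)" if "x \<in> carrier L" for x
    using h0 that by (simp add: h_def)
  have hM: "h x \<in> carrier M" if "x \<in> carrier L" for x
    using is_lubD(1)[OF h img] that by simp
  have hup: "f x \<sqsubseteq>\<^bsub>M\<^esub> h x" if "f \<in> F" "x \<in> carrier L" for f x
    using is_lubD(2)[OF h img] that by simp
  have hle: "h x \<sqsubseteq>\<^bsub>M\<^esub> u" if "x \<in> carrier L" "u \<in> carrier M" "\<And>f. f \<in> F \<Longrightarrow> f x \<sqsubseteq>\<^bsub>M\<^esub> u" for x u
    using is_lubD(3)[OF h img] that by auto
  have hC: "h \<in> carrier (fun_cpo L M)"
  proof -
    have "is_lub M (h x) (h ` X)" if X: "directed L X" and x: "is_lub L x X" for X x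
    proof (rule is_lubI)
      have XL: "X \<subseteq> carrier L" using X by (simp add: directed_def)
      have xL: "x \<in> carrier L" using is_lubD(1)[OF x XL] .
      show "h ` X \<subseteq> carrier M" "h x \<in> carrier M" using XL xL hM by auto
      show "y \<sqsubseteq>\<^bsub>M\<^esub> h x" if "y \<in> h ` X" for y
      proof -
        obtain z where z: "z \<in> X" "y = h z" using \<open>y \<in> h ` X\<close> by auto
        then have zL: "z \<in> carrier L" using XL by auto
        have "f z \<sqsubseteq>\<^bsub>M\<^esub> h x" if f: "f \<in> F" for f
          using fun_cpo_mono[OF L _ zL xL is_lubD(2)[OF x XL z(1)]] FC f hup[OF f xL]
          by (meson FM cpoD(2)[OF M] hM subsetD xL zL)
        then show ?thesis using hle[OF zL hM[OF xL]] z by simp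
      qed
      show "h x \<sqsubseteq>\<^bsub>M\<^esub> u" if u: "u \<in> carrier M" and b: "\<And>y. y \<in> h ` X \<Longrightarrow> y \<sqsubseteq>\<^bsub>M\<^esub> u" for u
      proof (rule hle[OF xL u])
        fix f assume f: "f \<in> F"
        then have fC: "f \<in> carrier (fun_cpo L M)" using FC by auto
        have fX: "f ` X \<subseteq> carrier M" using FM f XL by auto
        have "f z \<sqsubseteq>\<^bsub>M\<^esub> u" if z: "z \<in> X" for z
          using hup[OF f] b z XL u FM[OF f] hM cpoD(2)[OF M] by (meson imageI subsetD)
        then show "f x \<sqsubseteq>\<^bsub>M\<^esub> u"
          using is_lubD(3)[OF fun_cpoD(3)[OF fC X x] fX u] by auto
      qed
    qed
    then show ?thesis using hM by (auto simp: fun_cpo_def h_def)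
  qed
  have "is_lub (fun_cpo L M) h F"
  proof (rule is_lubI[OF FC hC])
    show "f \<sqsubseteq>\<^bsub>fun_cpo L M\<^esub> h" if "f \<in> F" for f
      using hup[OF that] by (simp add: fun_cpo_simps)
    show "h \<sqsubseteq>\<^bsub>fun_cpo L M\<^esub> u" if "u \<in> carrier (fun_cpo L M)"
      "\<And>f. f \<in> F \<Longrightarrow> f \<sqsubseteq>\<^bsub>fun_cpo L M\<^esub> u" for u
      using that hle fun_cpoD(2)[OF that(1)] by (simp add: fun_cpo_simps)
  qed
  then show ?thesis by (rule that[OF _ h])
qed

lemma cpo_fun_cpo:
  assumes L: "cpo L" and M: "cpo M"
  shows "cpo (fun_cpo L M)"
proof -
  obtain b where b: "b \<in> carrier M" "\<And>x. x \<in> carrier M \<Longrightarrow> b \<sqsubseteq>\<^bsub>M\<^esub> x"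
    using cpoD(5)[OF M] by (auto simp: least_def)
  show ?thesis
  proof (rule cpoI[where b = "\<lambda>x\<in>carrier L. b"])
    show "eq (fun_cpo L M) = (=)" by (simp add: fun_cpo_simps)
    show "x \<sqsubseteq>\<^bsub>fun_cpo L M\<^esub> x" if "x \<in> carrier (fun_cpo L M)" for x
      using that fun_cpoD(2) cpoD(1)[OF M] by (metis fun_cpo_simps(2))
    show "f \<sqsubseteq>\<^bsub>fun_cpo L M\<^esub> h" if "f \<sqsubseteq>\<^bsub>fun_cpo L M\<^esub> g" "g \<sqsubseteq>\<^bsub>fun_cpo L M\<^esub> h"
      "f \<in> carrier (fun_cpo L M)" "g \<in> carrier (fun_cpo L M)" "h \<in> carrier (fun_cpo L M)" for f g h
      using that fun_cpoD(2) cpoD(2)[OF M] unfolding fun_cpo_simps by meson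
    show "f = g" if fg: "f \<sqsubseteq>\<^bsub>fun_cpo L M\<^esub> g" "g \<sqsubseteq>\<^bsub>fun_cpo L M\<^esub> f"
      and C: "f \<in> carrier (fun_cpo L M)" "g \<in> carrier (fun_cpo L M)" for f g
    proof (rule PiE_ext)
      show "f \<in> carrier L \<rightarrow>\<^sub>E carrier M" "g \<in> carrier L \<rightarrow>\<^sub>E carrier M"
        by (rule fun_cpoD(1)[OF C(1)], rule fun_cpoD(1)[OF C(2)])
      show "f x = g x" if "x \<in> carrier L" for x
        by (rule cpoD(3)[OF M]) (use fg that C in \<open>simp_all add: fun_cpo_simps fun_cpoD(2)\<close>)
    qed
    show "\<exists>h. is_lub (fun_cpo L M) h F" if "directed (fun_cpo L M) F" for F
      using fun_cpo_lub[OF L M that] by metis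
    have "is_lub M ((\<lambda>x\<in>carrier L. b) x) ((\<lambda>x\<in>carrier L. b) ` X)"
      if X: "directed L X" and x: "is_lub L x X" for X x
    proof -
      have "X \<subseteq> carrier L" "X \<noteq> {}" using X by (auto simp: directed_def)
      then have "(\<lambda>x\<in>carrier L. b) ` X = {b}" "x \<in> carrier L"
        using is_lubD(1)[OF x] by (auto simp: subset_iff)
      then show ?thesis using b cpoD(1)[OF M] by (simp add: is_lub_iff)
    qed
    then show "(\<lambda>x\<in>carrier L. b) \<in> carrier (fun_cpo L M)"
      using b by (auto simp: fun_cpo_def)
    show "(\<lambda>x\<in>carrier L. b) \<sqsubseteq>\<^bsub>fun_cpo L M\<^esub> f" if "f \<in> carrier (fun_cpo L M)" for f
      using b fun_cpoD(2)[OF that] by (simp add: fun_cpo_simps)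
  qed
qed

lemma fun_cpo_lub_pointwise:
  assumes L: "cpo L" and M: "cpo M" and F: "directed (fun_cpo L M) F"
    and g: "is_lub (fun_cpo L M) g F" and x: "x \<in> carrier L"
  shows "is_lub M (g x) ((\<lambda>f. f x) ` F)"
proof -
  obtain h where h: "is_lub (fun_cpo L M) h F"
    "\<And>x. x \<in> carrier L \<Longrightarrow> is_lub M (h x) ((\<lambda>f. f x) ` F)"
    using fun_cpo_lub[OF L M F] by metis
  have "partial_order (fun_cpo L M)"
    using cpo_fun_cpo[OF L M] by (simp add: cpo_def)
  then have "g = h" using g h(1) by (rule partial_order.least_unique)
  then show ?thesis using h(2) x by simp
qed

text \<open>An increasing sequence of continuous maps with finite image converging to the identity.
  It makes continuous maps on \<open>L\<close> determined by countably many values, and it lifts to the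
  function space via $f \mapsto e_k \circ f \circ e_k$.\<close>

definition approximation :: "('a, 'c) gorder_scheme \<Rightarrow> (nat \<Rightarrow> 'a \<Rightarrow> 'a) \<Rightarrow> bool" where
  "approximation L e \<longleftrightarrow>
     (\<forall>k. e k \<in> carrier (fun_cpo L L) \<and> finite (e k ` carrier L)) \<and>
     (\<forall>x\<in>carrier L. directed L (range (\<lambda>k. e k x)) \<and> is_lub L x (range (\<lambda>k. e k x))) \<and>
     (\<forall>x\<in>carrier L. \<forall>j k. j \<le> k \<longrightarrow> e j x \<sqsubseteq>\<^bsub>L\<^esub> e k x)"

lemma approximation_fun_cpo:
  assumes L: "cpo L" and e: "approximation L e"
  shows "approximation (fun_cpo L L) (\<lambda>k. \<lambda>f\<in>carrier (fun_cpo L L). compose (carrier L) (e k) (compose (carrier L) f (e k)))"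
    (is "approximation ?F ?e")
proof -
  define E where "E = ?e"
  note cL = cpoD(1)[OF L] and tL = cpoD(2)[OF L]
  have eC: "e k \<in> carrier ?F" and efin: "finite (e k ` carrier L)" for k
    using e by (simp_all add: approximation_def)
  note eL [simp] = fun_cpoD(2)[OF eC]
  have edir: "directed L (range (\<lambda>k. e k x))" and elub: "is_lub L x (range (\<lambda>k. e k x))"
    and emon: "j \<le> k \<Longrightarrow> e j x \<sqsubseteq>\<^bsub>L\<^esub> e k x" if "x \<in> carrier L" for x j k
    using e that by (simp_all add: approximation_def)
  have comp: "compose (carrier L) g f \<in> carrier ?F"
    if f: "f \<in> carrier ?F" and g: "g \<in> carrier ?F" for f g
  proof -
    have "is_lub L (g (f x)) ((\<lambda>x\<in>carrier L. g (f x)) ` X)" if X: "directed L X" and x: "is_lub L x X" for X x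
    proof -
      have XL: "X \<subseteq> carrier L" using X by (simp add: directed_def)
      have "directed L (f ` X)"
        by (rule directed_image[OF X])
          (use XL fun_cpoD(2)[OF f] fun_cpo_mono[OF L f] in \<open>auto simp: subset_iff\<close>)
      then have "is_lub L (g (f x)) (g ` f ` X)"
        using fun_cpoD(3)[OF g] fun_cpoD(3)[OF f X x] by simp
      moreover have "g ` f ` X = (\<lambda>x\<in>carrier L. g (f x)) ` X"
        using XL by (auto simp: subset_iff image_iff)
      ultimately show ?thesis by simp
    qed
    moreover have "x \<in> carrier L" if "directed L X" "is_lub L x X" for X x
      using that is_lubD(1) by (auto simp: directed_def)
    ultimately show ?thesis
      using fun_cpoD(2)[OF f] fun_cpoD(2)[OF g] by (simp add: fun_cpo_def compose_def)
  qed
  have EC: "E k f \<in> carrier ?F" if "f \<in> carrier ?F" for k f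
    using that by (simp add: comp eC E_def)
  have Eapp: "E k f x = e k (f (e k x))" if "f \<in> carrier ?F" "x \<in> carrier L" for k f x
    using that by (simp add: compose_eq E_def)
  have fL: "f x \<in> carrier L" if "f \<in> carrier ?F" "x \<in> carrier L" for f x
    using that fun_cpoD(2) by metis
  have mon: "e j (f (e j x)) \<sqsubseteq>\<^bsub>L\<^esub> e k (f (e k x))"
    if "j \<le> k" and f: "f \<in> carrier ?F" and x: "x \<in> carrier L" for j k f x
  proof -
    have "f (e j x) \<sqsubseteq>\<^bsub>L\<^esub> f (e k x)"
      using fun_cpo_mono[OF L f] emon[OF x \<open>j \<le> k\<close>] x by simp
    then have "e j (f (e j x)) \<sqsubseteq>\<^bsub>L\<^esub> e j (f (e k x))"
      using fun_cpo_mono[OF L eC] fL[OF f] x by simp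
    moreover have "e j (f (e k x)) \<sqsubseteq>\<^bsub>L\<^esub> e k (f (e k x))"
      using emon \<open>j \<le> k\<close> fL[OF f] x by simp
    ultimately show ?thesis using tL fL[OF f] x eL by meson
  qed
  have Emon: "E j f \<sqsubseteq>\<^bsub>?F\<^esub> E k f" if "j \<le> k" "f \<in> carrier ?F" for j k f
    using mon[OF that] Eapp[OF that(2)] by (simp add: fun_cpo_simps)
  have low: "e k x \<sqsubseteq>\<^bsub>L\<^esub> x" if "x \<in> carrier L" for k x
    by (rule is_lubD(2)[OF elub[OF that]]) (use that in auto)
  have Elub: "is_lub ?F f (range (\<lambda>k. E k f))" if f: "f \<in> carrier ?F" for f
  proof (rule is_lubI)
    show "range (\<lambda>k. E k f) \<subseteq> carrier ?F" using EC[OF f] by auto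
    show "f \<in> carrier ?F" by (rule f)
    show "y \<sqsubseteq>\<^bsub>?F\<^esub> f" if "y \<in> range (\<lambda>k. E k f)" for y
    proof -
      obtain k where y: "y = E k f" using \<open>y \<in> range (\<lambda>k. E k f)\<close> by blast
      have "e k (f (e k x)) \<sqsubseteq>\<^bsub>L\<^esub> f x" if x: "x \<in> carrier L" for x
      proof -
        have "e k (f (e k x)) \<sqsubseteq>\<^bsub>L\<^esub> f (e k x)" using low fL[OF f] x by simp
        moreover have "f (e k x) \<sqsubseteq>\<^bsub>L\<^esub> f x" using fun_cpo_mono[OF L f] low x by simp
        ultimately show ?thesis using tL fL[OF f] x eL by meson
      qed
      then show ?thesis unfolding y fun_cpo_simps using Eapp[OF f] by simp
    qed
    fix g assume g: "g \<in> carrier ?F" and b: "\<And>y. y \<in> range (\<lambda>k. E k f) \<Longrightarrow> y \<sqsubseteq>\<^bsub>?F\<^esub> g"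
    have bb: "e k (f (e k x)) \<sqsubseteq>\<^bsub>L\<^esub> g x" if "x \<in> carrier L" for k x
      using b[OF rangeI, of k] Eapp[OF f that, of k] that unfolding fun_cpo_simps by metis
    have "f x \<sqsubseteq>\<^bsub>L\<^esub> g x" if x: "x \<in> carrier L" for x
    proof -
      have "f (e j x) \<sqsubseteq>\<^bsub>L\<^esub> g x" for j
      proof (rule is_lubD(3)[OF elub])
        show "f (e j x) \<in> carrier L" "range (\<lambda>k. e k (f (e j x))) \<subseteq> carrier L" "g x \<in> carrier L"
          using fL f g x by auto
        fix y assume "y \<in> range (\<lambda>k. e k (f (e j x)))"
        then obtain k where y: "y = e k (f (e j x))" by auto
        have "e j x \<sqsubseteq>\<^bsub>L\<^esub> e (max j k) x" using emon x by simp
        then have "f (e j x) \<sqsubseteq>\<^bsub>L\<^esub> f (e (max j k) x)"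
          using fun_cpo_mono[OF L f] x by simp
        then have "e k (f (e j x)) \<sqsubseteq>\<^bsub>L\<^esub> e k (f (e (max j k) x))"
          using fun_cpo_mono[OF L eC] fL[OF f] x by simp
        moreover have "e k (f (e (max j k) x)) \<sqsubseteq>\<^bsub>L\<^esub> e (max j k) (f (e (max j k) x))"
          using emon fL[OF f] x by simp
        ultimately have "e k (f (e j x)) \<sqsubseteq>\<^bsub>L\<^esub> e (max j k) (f (e (max j k) x))"
          using tL fL[OF f] x eL by meson
        then show "y \<sqsubseteq>\<^bsub>L\<^esub> g x"
          unfolding y using bb[OF x, of "max j k"] tL fL[OF f] fL[OF g] x eL by meson
      qed
      then show ?thesis
        by (intro is_lubD(3)[OF fun_cpoD(3)[OF f edir[OF x] elub[OF x]]]) (use fL f g x in auto)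
    qed
    then show "f \<sqsubseteq>\<^bsub>?F\<^esub> g" by (simp add: fun_cpo_simps)
  qed
  have Edir: "directed ?F (range (\<lambda>k. E k f))" if f: "f \<in> carrier ?F" for f
    unfolding directed_def
  proof (intro conjI ballI)
    show "range (\<lambda>k. E k f) \<subseteq> carrier ?F" using EC[OF f] by auto
    fix u v assume "u \<in> range (\<lambda>k. E k f)" "v \<in> range (\<lambda>k. E k f)"
    then obtain j k where uv: "u = E j f" "v = E k f" by blast
    show "\<exists>w\<in>range (\<lambda>k. E k f). u \<sqsubseteq>\<^bsub>?F\<^esub> w \<and> v \<sqsubseteq>\<^bsub>?F\<^esub> w"
      unfolding uv by (rule bexI[of _ "E (max j k) f"]) (auto intro!: Emon[OF _ f])
  qed simp
  have Econt: "E k \<in> carrier (fun_cpo ?F ?F)" for k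
  proof -
    have "is_lub ?F (E k g) (E k ` G)" if G: "directed ?F G" and g: "is_lub ?F g G" for G g
    proof (rule is_lubI)
      have GC: "G \<subseteq> carrier ?F" using G by (simp add: directed_def)
      have gC: "g \<in> carrier ?F" using is_lubD(1)[OF g GC] .
      show "E k ` G \<subseteq> carrier ?F" "E k g \<in> carrier ?F"
        using EC GC gC by (blast, blast)
      have le: "f x \<sqsubseteq>\<^bsub>L\<^esub> g x" if "f \<in> G" "x \<in> carrier L" for f x
        using is_lubD(2)[OF g GC that(1)] that(2) by (simp add: fun_cpo_simps)
      show "y \<sqsubseteq>\<^bsub>?F\<^esub> E k g" if y: "y \<in> E k ` G" for y
      proof -
        obtain f where f: "f \<in> G" "y = E k f" using y by blast
        then have fC: "f \<in> carrier ?F" using GC by auto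
        have "e k (f (e k x)) \<sqsubseteq>\<^bsub>L\<^esub> e k (g (e k x))" if "x \<in> carrier L" for x
          using fun_cpo_mono[OF L eC] le[OF f(1)] fL[OF fC] fL[OF gC] that by simp
        then show ?thesis
          unfolding f(2) fun_cpo_simps using Eapp[OF fC] Eapp[OF gC] by simp
      qed
      fix u assume u: "u \<in> carrier ?F" and b: "\<And>y. y \<in> E k ` G \<Longrightarrow> y \<sqsubseteq>\<^bsub>?F\<^esub> u"
      have "e k (g (e k x)) \<sqsubseteq>\<^bsub>L\<^esub> u x" if x: "x \<in> carrier L" for x
      proof (rule is_lubD(3))
        have "directed L ((\<lambda>f. f (e k x)) ` G)"
          by (rule directed_image[OF G]) (use GC fL x in \<open>auto simp: fun_cpo_simps subset_iff\<close>)
        then show "is_lub L (e k (g (e k x))) (e k ` (\<lambda>f. f (e k x)) ` G)"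
          using fun_cpoD(3)[OF eC] fun_cpo_lub_pointwise[OF L L G g] x by simp
        show "e k ` (\<lambda>f. f (e k x)) ` G \<subseteq> carrier L" "u x \<in> carrier L"
          using GC fL u x by (auto simp: subset_iff)
        fix y assume "y \<in> e k ` (\<lambda>f. f (e k x)) ` G"
        then obtain f where f: "f \<in> G" "y = e k (f (e k x))" by auto
        then have "f \<in> carrier ?F" using GC by auto
        then show "y \<sqsubseteq>\<^bsub>L\<^esub> u x"
          using b[OF imageI[OF f(1)]] Eapp x f(2) unfolding fun_cpo_simps by metis
      qed
      then show "E k g \<sqsubseteq>\<^bsub>?F\<^esub> u"
        unfolding fun_cpo_simps using Eapp[OF gC] by simp
    qed
    moreover have "E k \<in> carrier ?F \<rightarrow>\<^sub>E carrier ?F"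
      using EC by (auto simp: PiE_def extensional_def E_def)
    ultimately show ?thesis by (subst fun_cpo_def) simp
  qed
  have Efin: "finite (E k ` carrier ?F)" for k
  proof -
    let ?I = "e k ` carrier L"
    have "E k ` carrier ?F \<subseteq> (\<lambda>h. \<lambda>x\<in>carrier L. h (e k x)) ` (?I \<rightarrow>\<^sub>E ?I)"
    proof
      fix y assume "y \<in> E k ` carrier ?F"
      then obtain f where f: "f \<in> carrier ?F" "y = E k f" by blast
      have "y = (\<lambda>x\<in>carrier L. (\<lambda>z\<in>?I. e k (f z)) (e k x))"
        using f by (auto simp: compose_def E_def)
      moreover have "(\<lambda>z\<in>?I. e k (f z)) \<in> ?I \<rightarrow>\<^sub>E ?I"
        using fL[OF f(1)] by auto
      ultimately show "y \<in> (\<lambda>h. \<lambda>x\<in>carrier L. h (e k x)) ` (?I \<rightarrow>\<^sub>E ?I)" by blast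
    qed
    then show ?thesis
      using efin finite_PiE finite_subset finite_imageI by metis
  qed
  show ?thesis
    unfolding approximation_def E_def[symmetric] using Econt Efin Elub Edir Emon by blast
qed

lemma inj_on_code_fun_cpo:
  fixes L :: "code gorder"
  assumes L: "cpo L" and e: "approximation L e"
  shows "inj_on (code (fun_cpo L L)) (carrier (fun_cpo L L))"
proof -
  define B where "B = (\<Union>k. e k ` carrier L)"
  have eL: "e k x \<in> carrier L" if "x \<in> carrier L" for k x
    using e that fun_cpoD(2) unfolding approximation_def by metis
  have "countable (e k ` carrier L)" for k
    using e by (simp add: approximation_def countable_finite)
  then have "countable B" by (simp add: B_def)
  define c :: "(code \<Rightarrow> code) \<Rightarrow> code" where
    "c f = {m. \<exists>b\<in>B. \<exists>i\<in>f b. m = prod_encode (to_nat_on B b, i)}" for f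
  have cD: "f b = g b" if "c f = c g" "b \<in> B" for f g b
  proof -
    have "i \<in> f b \<longleftrightarrow> prod_encode (to_nat_on B b, i) \<in> c f" for f i
      using \<open>b \<in> B\<close> \<open>countable B\<close> by (auto simp: c_def prod_encode_eq)
    then show ?thesis using \<open>c f = c g\<close> by blast
  qed
  have "inj_on c (carrier (fun_cpo L L))"
  proof (rule inj_onI)
    fix f g assume f: "f \<in> carrier (fun_cpo L L)" and g: "g \<in> carrier (fun_cpo L L)"
      and "c f = c g"
    have "f x = g x" if x: "x \<in> carrier L" for x
    proof -
      have d: "directed L (range (\<lambda>k. e k x))" "is_lub L x (range (\<lambda>k. e k x))"
        using e x by (simp_all add: approximation_def)
      have "f (e k x) = g (e k x)" for k
        using cD[OF \<open>c f = c g\<close>] x by (auto simp: B_def)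
      then have "f ` range (\<lambda>k. e k x) = g ` range (\<lambda>k. e k x)"
        by (simp add: image_image)
      then have "is_lub L (f x) (f ` range (\<lambda>k. e k x))" "is_lub L (g x) (f ` range (\<lambda>k. e k x))"
        using fun_cpoD(3)[OF f d] fun_cpoD(3)[OF g d] by simp_all
      moreover have "partial_order L" using L by (simp add: cpo_def)
      ultimately show ?thesis by (meson partial_order.least_unique)
    qed
    then show "f = g" using fun_cpoD(1)[OF f] fun_cpoD(1)[OF g] by (meson PiE_ext)
  qed
  then show ?thesis
    unfolding code_def by (rule someI[where P = "\<lambda>c. inj_on c _"])
qed

lemma coded_simps:
  assumes "inj_on (code L) (carrier L)"
  shows "carrier (coded L) = code L ` carrier L"
    and "x \<in> carrier L \<Longrightarrow> y \<in> carrier L \<Longrightarrow> code L x \<sqsubseteq>\<^bsub>coded L\<^esub> code L y \<longleftrightarrow> x \<sqsubseteq>\<^bsub>L\<^esub> y"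
    and "x \<in> carrier L \<Longrightarrow> decode L (code L x) = x"
  using assms by (simp_all add: coded_def decode_def)

lemma is_lub_coded:
  assumes inj: "inj_on (code L) (carrier L)" and X: "X \<subseteq> carrier L" and x: "x \<in> carrier L"
  shows "is_lub (coded L) (code L x) (code L ` X) \<longleftrightarrow> is_lub L x X"
proof -
  have le: "code L y \<sqsubseteq>\<^bsub>coded L\<^esub> code L z \<longleftrightarrow> y \<sqsubseteq>\<^bsub>L\<^esub> z" if "y \<in> X \<or> y = x" "z \<in> carrier L" for y z
    using coded_simps(2)[OF inj] X x that by auto
  have "code L ` X \<subseteq> carrier (coded L)" using X by (auto simp: coded_def)
  then show ?thesis
    using x le by (simp add: is_lub_iff X coded_simps(1)[OF inj])
qed

lemma directed_coded:
  assumes inj: "inj_on (code L) (carrier L)"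
  shows "directed (coded L) Y \<longleftrightarrow> (\<exists>X. directed L X \<and> Y = code L ` X)"
proof
  assume Y: "directed (coded L) Y"
  then obtain X where X: "X \<subseteq> carrier L" "Y = code L ` X"
    using coded_simps(1)[OF inj] by (auto simp: directed_def subset_image_iff)
  have "directed L X"
    unfolding directed_def
  proof (intro conjI ballI)
    show "X \<subseteq> carrier L" "X \<noteq> {}" using X Y by (auto simp: directed_def)
    fix x y assume xy: "x \<in> X" "y \<in> X"
    then have "\<exists>w\<in>Y. code L x \<sqsubseteq>\<^bsub>coded L\<^esub> w \<and> code L y \<sqsubseteq>\<^bsub>coded L\<^esub> w"
      using Y X(2) unfolding directed_def by simp
    then obtain z where "z \<in> X" "code L x \<sqsubseteq>\<^bsub>coded L\<^esub> code L z" "code L y \<sqsubseteq>\<^bsub>coded L\<^esub> code L z"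
      unfolding X(2) by blast
    then show "\<exists>z\<in>X. x \<sqsubseteq>\<^bsub>L\<^esub> z \<and> y \<sqsubseteq>\<^bsub>L\<^esub> z"
      using coded_simps(2)[OF inj] X(1) xy by (meson subsetD)
  qed
  then show "\<exists>X. directed L X \<and> Y = code L ` X" using X by auto
next
  assume "\<exists>X. directed L X \<and> Y = code L ` X"
  then obtain X where X: "directed L X" "Y = code L ` X" by auto
  then show "directed (coded L) Y"
    using directed_image[OF X(1), of "code L" "coded L"] coded_simps[OF inj]
    by (auto simp: directed_def subset_iff)
qed

lemma cpo_coded:
  assumes inj: "inj_on (code L) (carrier L)" and L: "cpo L"
  shows "cpo (coded L)"
proof -
  note c = coded_simps[OF inj]
  obtain b where b: "b \<in> carrier L" "\<And>x. x \<in> carrier L \<Longrightarrow> b \<sqsubseteq>\<^bsub>L\<^esub> x"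
    using cpoD(5)[OF L] by (auto simp: least_def)
  show ?thesis
  proof (rule cpoI[where b = "code L b"])
    show "eq (coded L) = (=)" by (simp add: coded_def)
    show "\<exists>x. is_lub (coded L) x Y" if "directed (coded L) Y" for Y
    proof -
      obtain X where X: "directed L X" "Y = code L ` X"
        using \<open>directed (coded L) Y\<close> directed_coded[OF inj] by metis
      then obtain x where "is_lub L x X" using cpoD(4)[OF L] by auto
      moreover have "X \<subseteq> carrier L" using X by (simp add: directed_def)
      ultimately show ?thesis
        using is_lub_coded[OF inj] is_lubD(1) X(2) by metis
    qed
    show "x \<sqsubseteq>\<^bsub>coded L\<^esub> x" if "x \<in> carrier (coded L)" for x
      using that cpoD(1)[OF L] by (auto simp: c)
    show "x \<sqsubseteq>\<^bsub>coded L\<^esub> z" if le: "x \<sqsubseteq>\<^bsub>coded L\<^esub> y" "y \<sqsubseteq>\<^bsub>coded L\<^esub> z"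
      and C: "x \<in> carrier (coded L)" "y \<in> carrier (coded L)" "z \<in> carrier (coded L)" for x y z
    proof -
      obtain x' y' z' where "x = code L x'" "y = code L y'" "z = code L z'"
        "x' \<in> carrier L" "y' \<in> carrier L" "z' \<in> carrier L"
        using C unfolding c(1) by (elim imageE)
      then show ?thesis
        using le cpoD(2)[OF L, of x' y' z'] by (simp add: c(2))
    qed
    show "x = y" if le: "x \<sqsubseteq>\<^bsub>coded L\<^esub> y" "y \<sqsubseteq>\<^bsub>coded L\<^esub> x"
      and C: "x \<in> carrier (coded L)" "y \<in> carrier (coded L)" for x y
    proof -
      obtain x' y' where "x = code L x'" "y = code L y'" "x' \<in> carrier L" "y' \<in> carrier L"
        using C unfolding c(1) by (elim imageE)
      then show ?thesis
        using le cpoD(3)[OF L, of x' y'] by (simp add: c(2))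
    qed
    show "code L b \<in> carrier (coded L)" using b by (simp add: c)
    show "code L b \<sqsubseteq>\<^bsub>coded L\<^esub> x" if "x \<in> carrier (coded L)" for x
      using that b by (auto simp: c)
  qed
qed

lemma approximation_coded:
  assumes inj: "inj_on (code L) (carrier L)" and e: "approximation L e"
  shows "approximation (coded L) (\<lambda>k. \<lambda>u\<in>carrier (coded L). code L (e k (decode L u)))"
    (is "approximation _ ?E")
proof -
  note c = coded_simps[OF inj]
  have eC: "e k \<in> carrier (fun_cpo L L)" and efin: "finite (e k ` carrier L)" for k
    using e by (simp_all add: approximation_def)
  note eL = fun_cpoD(2)[OF eC]
  have E: "?E k (code L x) = code L (e k x)" if "x \<in> carrier L" for k x
    using that c by simp
  have EX: "?E k ` code L ` X = code L ` e k ` X" if "X \<subseteq> carrier L" for k X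
    unfolding image_image using that E by (intro image_cong) (auto simp: subset_iff)
  have "?E k \<in> carrier (fun_cpo (coded L) (coded L))" for k
  proof -
    have "is_lub (coded L) (?E k u) (?E k ` Y)"
      if Y: "directed (coded L) Y" and u: "is_lub (coded L) u Y" for Y u
    proof -
      obtain X where X: "directed L X" "Y = code L ` X"
        using Y directed_coded[OF inj] by metis
      have XL: "X \<subseteq> carrier L" using X by (simp add: directed_def)
      obtain x where x: "x \<in> carrier L" "u = code L x"
        using is_lubD(1)[OF u] Y c(1) unfolding directed_def by (metis imageE)
      have "is_lub L x X" using u is_lub_coded[OF inj XL x(1)] x X by simp
      then have "is_lub L (e k x) (e k ` X)" using fun_cpoD(3)[OF eC X(1)] by simp
      then have "is_lub (coded L) (code L (e k x)) (code L ` e k ` X)"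
        using is_lub_coded[OF inj image_subsetI eL[OF x(1)]] XL eL by (metis subsetD)
      then show ?thesis unfolding X(2) x(2) EX[OF XL] E[OF x(1)] .
    qed
    moreover have "?E k \<in> carrier (coded L) \<rightarrow>\<^sub>E carrier (coded L)"
      using eL c by auto
    ultimately show ?thesis by (subst fun_cpo_def) simp
  qed
  moreover have "finite (?E k ` carrier (coded L))" for k
    unfolding c(1) EX[OF order.refl, unfolded c(1)] using efin by simp
  moreover have "directed (coded L) (range (\<lambda>k. ?E k u)) \<and> is_lub (coded L) u (range (\<lambda>k. ?E k u))"
    if "u \<in> carrier (coded L)" for u
  proof -
    obtain x where x: "x \<in> carrier L" "u = code L x" using \<open>u \<in> _\<close> c(1) by (metis imageE)
    have R: "range (\<lambda>k. ?E k u) = code L ` range (\<lambda>k. e k x)"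
      unfolding x(2) E[OF x(1)] by (simp add: image_image)
    have d: "directed L (range (\<lambda>k. e k x))" "is_lub L x (range (\<lambda>k. e k x))"
      using e x(1) by (simp_all add: approximation_def)
    have "range (\<lambda>k. e k x) \<subseteq> carrier L" using eL[OF x(1)] by auto
    then show ?thesis
      unfolding R using d directed_coded[OF inj] is_lub_coded[OF inj _ x(1)] x(2) by metis
  qed
  moreover have "?E j u \<sqsubseteq>\<^bsub>coded L\<^esub> ?E k u" if "u \<in> carrier (coded L)" "j \<le> k" for u j k
  proof -
    obtain x where x: "x \<in> carrier L" "u = code L x" using \<open>u \<in> _\<close> c(1) by (metis imageE)
    have "e j x \<sqsubseteq>\<^bsub>L\<^esub> e k x" using e x(1) that(2) by (simp add: approximation_def)
    then show ?thesis unfolding x(2) E[OF x(1)] using c(2) eL x(1) by simp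
  qed
  ultimately show ?thesis unfolding approximation_def by blast
qed

lemma inj_code_Nplus: "inj_on (code Nplus) (carrier Nplus)"
proof -
  have "inj_on (\<lambda>x. case x of None \<Rightarrow> {} | Some m \<Rightarrow> {m}) (carrier Nplus)"
    by (auto simp: inj_on_def split: option.splits)
  then show ?thesis
    unfolding code_def by (rule someI[where P = "\<lambda>c. inj_on c _"])
qed

lemma Nplus_simps [simp]:
  "carrier Nplus = UNIV" "eq Nplus = (=)" "a \<sqsubseteq>\<^bsub>Nplus\<^esub> b \<longleftrightarrow> a = None \<or> a = b"
  by (simp_all add: Nplus_def)

lemma directed_Nplus:
  assumes "directed Nplus X"
  shows "\<exists>x\<in>X. \<forall>y\<in>X. y \<sqsubseteq>\<^bsub>Nplus\<^esub> x"
proof (cases "X = {None}")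
  case False
  moreover have "X \<noteq> {}" using assms by (simp add: directed_def)
  ultimately have "\<not> X \<subseteq> {None}" by (simp add: subset_singleton_iff)
  then obtain x where x: "x \<in> X" "x \<noteq> None" by (metis singletonI subsetI)
  then have "\<forall>y\<in>X. \<exists>z\<in>X. x \<sqsubseteq>\<^bsub>Nplus\<^esub> z \<and> y \<sqsubseteq>\<^bsub>Nplus\<^esub> z"
    using assms by (simp add: directed_def)
  then show ?thesis using x by auto
qed auto

lemma is_lub_Nplus:
  assumes "x \<in> X" "\<And>y. y \<in> X \<Longrightarrow> y \<sqsubseteq>\<^bsub>Nplus\<^esub> x"
  shows "is_lub Nplus z X \<longleftrightarrow> z = x"
proof -
  have "y = None \<or> y = x" if "y \<in> X" for y
    using assms(2)[OF that] by simp
  then show ?thesis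
    using assms(1) by (simp add: is_lub_iff) (metis (full_types))
qed

lemma cpo_Nplus: "cpo Nplus"
proof (rule cpoI[where b = None])
  show "\<exists>x. is_lub Nplus x X" if "directed Nplus X" for X
    using directed_Nplus[OF that] is_lub_Nplus by metis
qed auto

lemma approximation_Nplus:
  "approximation Nplus (\<lambda>k x. case x of None \<Rightarrow> None | Some m \<Rightarrow> if m < k then Some m else None)"
    (is "approximation _ ?e")
proof -
  have "is_lub Nplus (?e k x) (?e k ` X)" if X: "directed Nplus X" and x: "is_lub Nplus x X" for X x k
  proof -
    obtain y where y: "y \<in> X" "\<forall>z\<in>X. z \<sqsubseteq>\<^bsub>Nplus\<^esub> y" using directed_Nplus[OF X] by auto
    then have "x = y" using x is_lub_Nplus by metis
    then have "?e k x \<in> ?e k ` X" and "\<And>z. z \<in> ?e k ` X \<Longrightarrow> z \<sqsubseteq>\<^bsub>Nplus\<^esub> ?e k x"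
      using y by (auto split: option.splits)
    then show ?thesis by (intro iffD2[OF is_lub_Nplus refl])
  qed
  then have "?e k \<in> carrier (fun_cpo Nplus Nplus)" for k
    by (simp add: fun_cpo_def)
  moreover have "finite (range (?e k))" for k
    by (rule finite_subset[of _ "insert None (Some ` {..<k})"]) (auto split: option.splits)
  moreover have "directed Nplus (range (\<lambda>k. ?e k x)) \<and> is_lub Nplus x (range (\<lambda>k. ?e k x))" for x
  proof -
    have x: "x \<in> range (\<lambda>k. ?e k x)"
      by (cases x) (auto intro: range_eqI[of _ _ "Suc (the x)"])
    moreover have le: "y \<sqsubseteq>\<^bsub>Nplus\<^esub> x" if "y \<in> range (\<lambda>k. ?e k x)" for y
      using that by (auto split: option.splits if_splits)
    ultimately have "is_lub Nplus x (range (\<lambda>k. ?e k x))"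
      by (intro iffD2[OF is_lub_Nplus refl])
    moreover have "directed Nplus (range (\<lambda>k. ?e k x))"
      unfolding directed_def using le by (intro conjI ballI bexI[OF _ x]) auto
    ultimately show ?thesis by simp
  qed
  ultimately show ?thesis
    by (auto simp: approximation_def split: option.splits)
qed

lemma D_cpo_approximation: "cpo (D n) \<and> (\<exists>e. approximation (D n) e)"
proof (induction n)
  case 0
  show ?case
    using cpo_coded[OF inj_code_Nplus cpo_Nplus]
      approximation_coded[OF inj_code_Nplus approximation_Nplus] by auto
next
  case (Suc n)
  then obtain e where L: "cpo (D n)" and e: "approximation (D n) e" by auto
  note inj = inj_on_code_fun_cpo[OF L e]
  show ?case
    using cpo_coded[OF inj cpo_fun_cpo[OF L L]]
      approximation_coded[OF inj approximation_fun_cpo[OF L e]] by auto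
qed

lemma cpo_D: "cpo (D n)"
  using D_cpo_approximation by simp

lemma inj_on_code_D:
  "inj_on (code Nplus) (carrier Nplus)"
  "inj_on (code (fun_cpo (D n) (D n))) (carrier (fun_cpo (D n) (D n)))"
  using inj_code_Nplus D_cpo_approximation inj_on_code_fun_cpo by metis+

text \<open>\<open>fn n\<close> and \<open>el n\<close> pass between an element of \<open>D (Suc n)\<close> and the function
  in \<open>[D n \<rightarrow> D n]\<close> that it stands for.\<close>

definition fn :: "nat \<Rightarrow> code \<Rightarrow> (code \<Rightarrow> code)" where
  "fn n = decode (fun_cpo (D n) (D n))"

definition el :: "nat \<Rightarrow> (code \<Rightarrow> code) \<Rightarrow> code" where
  "el n = code (fun_cpo (D n) (D n))"

text \<open>Hence \<open>fn n\<close> is an order isomorphism from \<open>D (Suc n)\<close> onto \<open>[D n \<rightarrow> D n]\<close>, with inverse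
  \<open>el n\<close>.\<close>

lemma bij_betw_fn: "bij_betw (fn n) (carrier (D (Suc n))) (carrier (fun_cpo (D n) (D n)))"
  and el_fn: "d \<in> carrier (D (Suc n)) \<Longrightarrow> el n (fn n d) = d"
  and fn_el: "f \<in> carrier (fun_cpo (D n) (D n)) \<Longrightarrow> fn n (el n f) = f"
  and le_D_Suc: "d \<sqsubseteq>\<^bsub>D (Suc n)\<^esub> d' \<longleftrightarrow> fn n d \<sqsubseteq>\<^bsub>fun_cpo (D n) (D n)\<^esub> fn n d'"
  using inj_on_code_D(2)[of n]
  by (auto simp: coded_def fn_def el_def decode_def f_inv_into_f
      intro!: bij_betw_inv_into inj_on_imp_bij_betw)

fun \<phi> :: "nat \<Rightarrow> code \<Rightarrow> code" and \<psi> :: "nat \<Rightarrow> code \<Rightarrow> code" where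
  "\<phi> 0 d = el 0 (\<lambda>x\<in>carrier (D 0). d)"
| "\<psi> 0 g = fn 0 g \<bottom>\<^bsub>D 0\<^esub>"
| "\<phi> (Suc n) d = el (Suc n) (\<lambda>x\<in>carrier (D (Suc n)). \<phi> n (fn n d (\<psi> n x)))"
| "\<psi> (Suc n) g = el n (\<lambda>x\<in>carrier (D n). \<psi> n (fn (Suc n) g (\<phi> n x)))"

definition D_inf :: "(nat \<Rightarrow> code) gorder" where
  "D_inf = \<lparr>carrier = {d. \<forall>n. d n \<in> carrier (D n) \<and> \<psi> n (d (Suc n)) = d n},
            eq = (=),
            le = (\<lambda>d e. \<forall>n. d n \<sqsubseteq>\<^bsub>D n\<^esub> e n)\<rparr>"


section \<open>$n$-paths\<close>

text \<open>A point $(t_1,\dots,t_n)$ of the cube is an (extensional) function on \<open>{1..n}\<close>.\<close>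

definition cube :: "nat \<Rightarrow> (nat \<Rightarrow> real) topology" where
  "cube n = product_topology (\<lambda>_. top_of_set {0..1}) {1..n}"

definition npath :: "'a topology \<Rightarrow> nat \<Rightarrow> 'a \<Rightarrow> 'a \<Rightarrow> ((nat \<Rightarrow> real) \<Rightarrow> 'a) \<Rightarrow> bool" where
  "npath X n a b p \<longleftrightarrow> n \<ge> 1 \<and> continuous_map (cube n) X p \<and>
     (\<forall>t\<in>topspace (cube n). (t n = 0 \<longrightarrow> p t = a) \<and> (t n = 1 \<longrightarrow> p t = b))"

text \<open>\<open>fix_vars n [a\<^sub>1, \<dots>, a\<^sub>k] p\<close> is $p[t_1=a_1,\dots,t_k=a_k]$ for a map \<open>p\<close> of \<open>n\<close> variables,
  with the remaining variables $t_{k+1},\dots,t_n$ renumbered as $t_1,\dots,t_{n-k}$.\<close>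

definition fix_vars :: "nat \<Rightarrow> real list \<Rightarrow> ((nat \<Rightarrow> real) \<Rightarrow> 'a) \<Rightarrow> (nat \<Rightarrow> real) \<Rightarrow> 'a" where
  "fix_vars n as p = (\<lambda>t. p (\<lambda>i\<in>{1..n}. if i \<le> length as then as ! (i - 1) else t (i - length as)))"

definition npath_homotopic ::
    "'a topology \<Rightarrow> nat \<Rightarrow> 'a \<Rightarrow> 'a \<Rightarrow> ((nat \<Rightarrow> real) \<Rightarrow> 'a) \<Rightarrow> ((nat \<Rightarrow> real) \<Rightarrow> 'a) \<Rightarrow> bool" where
  "npath_homotopic X n a b p q \<longleftrightarrow> npath X n a b p \<and> npath X n a b q \<and>
     (\<exists>P. npath X (n + 1) a b P \<and>
       (\<forall>t\<in>topspace (cube n). fix_vars (n + 1) [0] P t = p t \<and> fix_vars (n + 1) [1] P t = q t))"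

definition parallel ::
    "'a topology \<Rightarrow> nat \<Rightarrow> 'a \<Rightarrow> 'a \<Rightarrow> ((nat \<Rightarrow> real) \<Rightarrow> 'a) \<Rightarrow> ((nat \<Rightarrow> real) \<Rightarrow> 'a) \<Rightarrow> bool" where
  "parallel X n a b p q \<longleftrightarrow> npath X n a b p \<and> npath X n a b q \<and>
     (\<forall>r\<in>{1..n-1}. \<forall>t\<in>topspace (cube (n - r)).
        fix_vars n (replicate r 0) p t = fix_vars n (replicate r 0) q t \<and>
        fix_vars n (replicate r 1) p t = fix_vars n (replicate r 1) q t)"

end

theory Submission
  imports Defs
begin

text \<open>Every $D_n$, and hence $D_\infty$, has binary meets, and in $D_\infty$ every open set
  containing \<open>x\<close> contains some \<open>k\<close> whose up-set is a neighbourhood of \<open>x\<close>. The latter makes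
  $t \mapsto p(t) \sqcap q(t)$ continuous, so that the map equal to \<open>p\<close> for $s < 1/2$, to
  $p \sqcap q$ for $s = 1/2$ and to \<open>q\<close> for $s > 1/2$ is a homotopy; it is constant on the two
  faces $t_n = 0, 1$ because $a \sqcap a = a$ and $b \sqcap b = b$.\<close>

section \<open>Scott-continuous maps\<close>

text \<open>The glued map is continuous because Scott open sets are upward closed: one that contains
  the meet of p(t) and q(t) contains both values, so the preimage of an open set is a union of three
  open sets. Two obstacles shape the rest. Pointwise meets of Scott-continuous maps need not be
  Scott-continuous, so meets are not lifted from D_n to D_(n+1) directly. What is lifted is the
  existence of sups of pairs bounded above, since pointwise sups commute with directed sups; meets
  are then recovered inside each D_n as sups of sets of common lower bounds. Moreover, p and q
  together give a continuous map only into the product of two Scott topologies, whereas Scott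
  continuity of the meet would speak of the Scott topology of the product order, which may be finer.
  The approximation by \<open>k\<close> closes this gap. For D_n it comes from the maps with finite
  image that converge to the identity, already used for the coding; it passes to D_inf along the
  embeddings and projections.\<close>

definition scott_continuous :: "('a, 'c) gorder_scheme \<Rightarrow> ('b, 'd) gorder_scheme \<Rightarrow> ('a \<Rightarrow> 'b) \<Rightarrow> bool" where
  "scott_continuous L M f \<longleftrightarrow> f \<in> carrier L \<rightarrow> carrier M \<and>
     (\<forall>X x. directed L X \<longrightarrow> is_lub L x X \<longrightarrow> is_lub M (f x) (f ` X))"

lemma scott_continuousD:
  assumes "scott_continuous L M f"
  shows "x \<in> carrier L \<Longrightarrow> f x \<in> carrier M"
    and "directed L X \<Longrightarrow> is_lub L x X \<Longrightarrow> is_lub M (f x) (f ` X)"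
  using assms by (auto simp: scott_continuous_def)

lemma directed_subset: "directed L X \<Longrightarrow> X \<subseteq> carrier L"
  by (simp add: directed_def)

lemma restrict_image: "X \<subseteq> A \<Longrightarrow> restrict f A ` X = f ` X"
  by (auto simp: subset_iff image_iff)

text \<open>\<open>scott_continuous\<close> leaves a map free off the carrier, so that maps compose
  as plain lambda terms; restriction yields the extensional representative that
  \<open>fun_cpo\<close> demands.\<close>

lemma restrict_in_fun_cpo:
  assumes f: "scott_continuous L M f"
  shows "restrict f (carrier L) \<in> carrier (fun_cpo L M)"
proof -
  have "is_lub M (restrict f (carrier L) x) (restrict f (carrier L) ` X)"
    if X: "directed L X" and x: "is_lub L x X" for X x
    using scott_continuousD(2)[OF f X x] is_lubD(1)[OF x directed_subset[OF X]]
      restrict_image[OF directed_subset[OF X]] by (metis restrict_apply')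
  then show ?thesis
    using scott_continuousD(1)[OF f] by (simp add: fun_cpo_def)
qed

lemma fun_cpo_scott_continuous: "f \<in> carrier (fun_cpo L M) \<Longrightarrow> scott_continuous L M f"
  by (auto simp: scott_continuous_def fun_cpo_def)

lemma scott_continuous_mono:
  assumes "cpo L" "scott_continuous L M f" "x \<in> carrier L" "y \<in> carrier L" "x \<sqsubseteq>\<^bsub>L\<^esub> y"
  shows "f x \<sqsubseteq>\<^bsub>M\<^esub> f y"
  using fun_cpo_mono[OF assms(1) restrict_in_fun_cpo[OF assms(2)] assms(3-5)] assms(3,4) by simp

lemma scott_continuous_directed:
  assumes "cpo L" "scott_continuous L M f" "directed L X"
  shows "directed M (f ` X)"
  by (rule directed_image[OF assms(3)])
    (use scott_continuous_mono[OF assms(1,2)] scott_continuousD(1)[OF assms(2)]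
      directed_subset[OF assms(3)] in blast)+

lemma scott_continuous_compose:
  assumes L: "cpo L" and f: "scott_continuous L M f" and g: "scott_continuous M N g"
  shows "scott_continuous L N (\<lambda>x. g (f x))"
  unfolding scott_continuous_def
proof (intro conjI allI impI)
  show "(\<lambda>x. g (f x)) \<in> carrier L \<rightarrow> carrier N"
    using scott_continuousD(1)[OF f] scott_continuousD(1)[OF g] by auto
  fix X x assume X: "directed L X" and x: "is_lub L x X"
  show "is_lub N (g (f x)) ((\<lambda>x. g (f x)) ` X)"
    using scott_continuousD(2)[OF g scott_continuous_directed[OF L f X] scott_continuousD(2)[OF f X x]]
    by (simp add: image_image)
qed

lemma scott_continuous_cong:
  assumes f: "scott_continuous L M f" and eq: "\<And>x. x \<in> carrier L \<Longrightarrow> f x = g x"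
  shows "scott_continuous L M g"
  unfolding scott_continuous_def
proof (intro conjI allI impI)
  show "g \<in> carrier L \<rightarrow> carrier M"
    using scott_continuousD(1)[OF f] eq by auto
  fix X x assume X: "directed L X" and x: "is_lub L x X"
  have "f ` X = g ` X"
    using eq directed_subset[OF X] by (intro image_cong) auto
  then show "is_lub M (g x) (g ` X)"
    using scott_continuousD(2)[OF f X x] eq[OF is_lubD(1)[OF x directed_subset[OF X]]] by simp
qed

lemma scott_continuous_const:
  assumes L: "cpo L" and M: "cpo M" and c: "c \<in> carrier M"
  shows "scott_continuous L M (\<lambda>x. c)"
proof -
  have "is_lub M c ((\<lambda>x. c) ` X)" if "directed L X" for X
    using that c cpoD(1)[OF M] by (auto simp: directed_def is_lub_iff image_constant_conv)
  then show ?thesis using c by (simp add: scott_continuous_def)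
qed

lemma scott_continuous_ident: "scott_continuous L L (\<lambda>x. x)"
  by (simp add: scott_continuous_def)

lemma scott_open_vimage:
  assumes L: "cpo L" and f: "scott_continuous L M f" and U: "scott_open M U"
  shows "scott_open L {x \<in> carrier L. f x \<in> U}"
  unfolding scott_open_def
proof (intro conjI allI impI ballI)
  show "y \<in> {x \<in> carrier L. f x \<in> U}"
    if "x \<in> {x \<in> carrier L. f x \<in> U}" "y \<in> carrier L" "x \<sqsubseteq>\<^bsub>L\<^esub> y" for x y
    using that scott_continuous_mono[OF L f] scott_openD(2)[OF U] scott_continuousD(1)[OF f] by auto
  fix X x assume X: "directed L X" "is_lub L x X" and x: "x \<in> {x \<in> carrier L. f x \<in> U}"
  obtain z where "z \<in> f ` X" "z \<in> U"
    using scott_openD(3)[OF U scott_continuous_directed[OF L f X(1)] scott_continuousD(2)[OF f X]] x by auto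
  then show "X \<inter> {x \<in> carrier L. f x \<in> U} \<noteq> {}"
    using directed_subset[OF X(1)] by auto
qed auto

lemma is_lub_fun_cpoI:
  assumes F: "F \<subseteq> carrier (fun_cpo L M)" and f: "f \<in> carrier (fun_cpo L M)"
    and lub: "\<And>x. x \<in> carrier L \<Longrightarrow> is_lub M (f x) ((\<lambda>g. g x) ` F)"
  shows "is_lub (fun_cpo L M) f F"
proof (rule is_lubI[OF F f])
  have sub: "(\<lambda>g. g x) ` F \<subseteq> carrier M" if "x \<in> carrier L" for x
  proof (rule image_subsetI)
    show "g x \<in> carrier M" if "g \<in> F" for g
      using fun_cpoD(2)[OF subsetD[OF F that] \<open>x \<in> carrier L\<close>] .
  qed
  show "g \<sqsubseteq>\<^bsub>fun_cpo L M\<^esub> f" if "g \<in> F" for g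
    using is_lubD(2)[OF lub sub] that by (auto simp: fun_cpo_simps)
  show "f \<sqsubseteq>\<^bsub>fun_cpo L M\<^esub> u" if u: "u \<in> carrier (fun_cpo L M)"
    and le: "\<And>g. g \<in> F \<Longrightarrow> g \<sqsubseteq>\<^bsub>fun_cpo L M\<^esub> u" for u
    unfolding fun_cpo_simps
  proof
    fix x assume x: "x \<in> carrier L"
    show "f x \<sqsubseteq>\<^bsub>M\<^esub> u x"
      by (rule is_lubD(3)[OF lub sub fun_cpoD(2)[OF u]]) (use x le in \<open>auto simp: fun_cpo_simps\<close>)
  qed
qed

lemma scott_continuous_eval:
  assumes "cpo L" "cpo M" "x \<in> carrier L"
  shows "scott_continuous (fun_cpo L M) M (\<lambda>f. f x)"
  unfolding scott_continuous_def
proof (intro conjI allI impI)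
  show "(\<lambda>f. f x) \<in> carrier (fun_cpo L M) \<rightarrow> carrier M"
    using fun_cpoD(2)[OF _ assms(3)] by blast
  show "is_lub M (f x) ((\<lambda>f. f x) ` F)" if "directed (fun_cpo L M) F" "is_lub (fun_cpo L M) f F" for F f
    using fun_cpo_lub_pointwise[OF assms(1,2) that assms(3)] .
qed

text \<open>Continuity in each variable separately is enough, because directed sups in the function
  space are computed pointwise.\<close>

lemma scott_continuous_curry:
  assumes L: "cpo L" and M: "cpo M" and N: "cpo N"
    and f: "\<And>x. x \<in> carrier L \<Longrightarrow> scott_continuous M N (f x)"
    and f': "\<And>y. y \<in> carrier M \<Longrightarrow> scott_continuous L N (\<lambda>x. f x y)"
  shows "scott_continuous L (fun_cpo M N) (\<lambda>x. restrict (f x) (carrier M))"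
  unfolding scott_continuous_def
proof (intro conjI allI impI)
  show C: "(\<lambda>x. restrict (f x) (carrier M)) \<in> carrier L \<rightarrow> carrier (fun_cpo M N)"
    using restrict_in_fun_cpo[OF f] by auto
  fix X x assume X: "directed L X" and x: "is_lub L x X"
  have XL: "X \<subseteq> carrier L" and xL: "x \<in> carrier L"
    using X x is_lubD(1) by (auto simp: directed_def)
  show "is_lub (fun_cpo M N) (restrict (f x) (carrier M)) ((\<lambda>x. restrict (f x) (carrier M)) ` X)"
  proof (rule is_lub_fun_cpoI)
    show "(\<lambda>x. restrict (f x) (carrier M)) ` X \<subseteq> carrier (fun_cpo M N)"
      "restrict (f x) (carrier M) \<in> carrier (fun_cpo M N)"
      using C XL xL by auto
    show "is_lub N (restrict (f x) (carrier M) y) ((\<lambda>g. g y) ` (\<lambda>x. restrict (f x) (carrier M)) ` X)"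
      if "y \<in> carrier M" for y
      using scott_continuousD(2)[OF f'[OF that] X x] that by (simp add: image_image)
  qed
qed

text \<open>Serves both recursive clauses: \<open>h\<close>, \<open>k\<close> become
  \<open>\<phi> n\<close>, \<open>\<psi> n\<close> for \<open>\<phi> (Suc n)\<close>, and the other
  way round for \<open>\<psi> (Suc n)\<close>.\<close>

lemma scott_continuous_conjugate:
  assumes L: "cpo L" and M: "cpo M" and h: "scott_continuous L M h" and k: "scott_continuous M L k"
  shows "scott_continuous (fun_cpo L L) (fun_cpo M M) (\<lambda>f. \<lambda>x\<in>carrier M. h (f (k x)))"
proof (rule scott_continuous_curry[OF cpo_fun_cpo[OF L L] M M])
  show "scott_continuous M M (\<lambda>x. h (f (k x)))" if "f \<in> carrier (fun_cpo L L)" for f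
    by (intro scott_continuous_compose[OF M _ h] scott_continuous_compose[OF M k]
        fun_cpo_scott_continuous that)
  show "scott_continuous (fun_cpo L L) M (\<lambda>f. h (f (k x)))" if "x \<in> carrier M" for x
    using scott_continuousD(1)[OF k that]
    by (intro scott_continuous_compose[OF cpo_fun_cpo[OF L L] _ h] scott_continuous_eval L)
qed

section \<open>Bounded completeness\<close>

text \<open>Pairs suffice: with a least element and directed sups they yield sups of all sets that
  are bounded above.\<close>

definition bounded_complete :: "('a, 'c) gorder_scheme \<Rightarrow> bool" where
  "bounded_complete L \<longleftrightarrow> (\<forall>x\<in>carrier L. \<forall>y\<in>carrier L. \<forall>u\<in>carrier L.
     x \<sqsubseteq>\<^bsub>L\<^esub> u \<longrightarrow> y \<sqsubseteq>\<^bsub>L\<^esub> u \<longrightarrow> (\<exists>z. is_lub L z {x, y}))"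

text \<open>Characterising a meet by its lower bounds lets an adjunction act on it directly; that
  \<open>m\<close> is itself a lower bound is the case \<open>z = m\<close>.\<close>

definition is_meet :: "('a, 'c) gorder_scheme \<Rightarrow> 'a \<Rightarrow> 'a \<Rightarrow> 'a \<Rightarrow> bool" where
  "is_meet L x y m \<longleftrightarrow> m \<in> carrier L \<and>
     (\<forall>z\<in>carrier L. z \<sqsubseteq>\<^bsub>L\<^esub> m \<longleftrightarrow> z \<sqsubseteq>\<^bsub>L\<^esub> x \<and> z \<sqsubseteq>\<^bsub>L\<^esub> y)"

text \<open>The common lower bounds of \<open>x\<close> and \<open>y\<close> form a directed set:
  bottom is one, and two of them are bounded by \<open>x\<close>, so they have a sup, which is again
  below \<open>x\<close> and \<open>y\<close>. The sup of this directed set is the meet.\<close>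

lemma bounded_complete_meet:
  assumes L: "cpo L" and bc: "bounded_complete L" and x: "x \<in> carrier L" and y: "y \<in> carrier L"
  shows "\<exists>m. is_meet L x y m"
proof -
  let ?X = "{z \<in> carrier L. z \<sqsubseteq>\<^bsub>L\<^esub> x \<and> z \<sqsubseteq>\<^bsub>L\<^esub> y}"
  have "directed L ?X"
    unfolding directed_def
  proof (intro conjI ballI)
    show "?X \<noteq> {}" using cpoD(5)[OF L] x y by (auto simp: least_def)
    fix u v assume u: "u \<in> ?X" and v: "v \<in> ?X"
    then obtain w where w: "is_lub L w {u, v}"
      using bc x unfolding bounded_complete_def by blast
    have uv: "{u, v} \<subseteq> carrier L" using u v by simp
    note w = is_lubD[OF w uv]
    have "w \<in> ?X" using w(1) w(3)[OF x] w(3)[OF y] u v by auto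
    then show "\<exists>z\<in>?X. u \<sqsubseteq>\<^bsub>L\<^esub> z \<and> v \<sqsubseteq>\<^bsub>L\<^esub> z" using w(2) by blast
  qed auto
  then obtain m where "is_lub L m ?X" using cpoD(4)[OF L] by blast
  then have m: "m \<in> carrier L" "\<And>z. z \<in> ?X \<Longrightarrow> z \<sqsubseteq>\<^bsub>L\<^esub> m"
    "\<And>u. u \<in> carrier L \<Longrightarrow> (\<And>z. z \<in> ?X \<Longrightarrow> z \<sqsubseteq>\<^bsub>L\<^esub> u) \<Longrightarrow> m \<sqsubseteq>\<^bsub>L\<^esub> u"
    using is_lubD[of L m ?X] by auto
  have "m \<sqsubseteq>\<^bsub>L\<^esub> x" "m \<sqsubseteq>\<^bsub>L\<^esub> y" using m(3) x y by auto
  then have "z \<sqsubseteq>\<^bsub>L\<^esub> m \<longleftrightarrow> z \<sqsubseteq>\<^bsub>L\<^esub> x \<and> z \<sqsubseteq>\<^bsub>L\<^esub> y" if "z \<in> carrier L" for z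
    using that m(1,2) x y cpoD(2)[OF L, of z m] by blast
  then show ?thesis using m(1) unfolding is_meet_def by blast
qed

text \<open>The sup is taken pointwise, and it is Scott-continuous because sups commute with sups.
  For pointwise meets this argument breaks down.\<close>

lemma bounded_complete_fun_cpo:
  assumes L: "cpo L" and M: "cpo M" and bc: "bounded_complete M"
  shows "bounded_complete (fun_cpo L M)"
  unfolding bounded_complete_def
proof (intro ballI impI)
  fix f g u
  assume f: "f \<in> carrier (fun_cpo L M)" and g: "g \<in> carrier (fun_cpo L M)"
    and u: "u \<in> carrier (fun_cpo L M)" and le: "f \<sqsubseteq>\<^bsub>fun_cpo L M\<^esub> u" "g \<sqsubseteq>\<^bsub>fun_cpo L M\<^esub> u"
  have fM: "f x \<in> carrier M" and gM: "g x \<in> carrier M" if "x \<in> carrier L" for x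
    using fun_cpoD(2)[OF f that] fun_cpoD(2)[OF g that] by auto
  have "\<exists>z. is_lub M z {f x, g x}" if "x \<in> carrier L" for x
    using bc fM[OF that] gM[OF that] fun_cpoD(2)[OF u that] le that
    unfolding bounded_complete_def fun_cpo_simps by blast
  then obtain h where hlub: "\<And>x. x \<in> carrier L \<Longrightarrow> is_lub M (h x) {f x, g x}" by metis
  have "{f x, g x} \<subseteq> carrier M" if "x \<in> carrier L" for x using fM gM that by simp
  note h = is_lubD[OF hlub this]
  have hM: "h x \<in> carrier M" and fh: "f x \<sqsubseteq>\<^bsub>M\<^esub> h x" and gh: "g x \<sqsubseteq>\<^bsub>M\<^esub> h x" if "x \<in> carrier L" for x
    using h that by auto
  have hle: "h x \<sqsubseteq>\<^bsub>M\<^esub> v" if "x \<in> carrier L" "v \<in> carrier M" "f x \<sqsubseteq>\<^bsub>M\<^esub> v" "g x \<sqsubseteq>\<^bsub>M\<^esub> v" for x v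
    using h(3) that by blast
  have "is_lub M (h x) (h ` X)" if X: "directed L X" and x: "is_lub L x X" for X x
  proof (rule is_lubI)
    have XL: "X \<subseteq> carrier L" and xL: "x \<in> carrier L"
      using X x is_lubD(1) by (auto simp: directed_def)
    show "h ` X \<subseteq> carrier M" "h x \<in> carrier M" using hM XL xL by auto
    show "y \<sqsubseteq>\<^bsub>M\<^esub> h x" if "y \<in> h ` X" for y
    proof -
      obtain z where z: "z \<in> X" "y = h z" using \<open>y \<in> h ` X\<close> by auto
      then have zL: "z \<in> carrier L" and zx: "z \<sqsubseteq>\<^bsub>L\<^esub> x" using XL is_lubD(2)[OF x XL] by auto
      have "f z \<sqsubseteq>\<^bsub>M\<^esub> h x" "g z \<sqsubseteq>\<^bsub>M\<^esub> h x"
        using cpoD(2)[OF M fun_cpo_mono[OF L f zL xL zx] fh[OF xL]]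
          cpoD(2)[OF M fun_cpo_mono[OF L g zL xL zx] gh[OF xL]] fM gM hM zL xL by auto
      then show ?thesis
        unfolding z(2) by (rule hle[OF zL hM[OF xL]])
    qed
    fix v assume v: "v \<in> carrier M" and ub: "\<And>y. y \<in> h ` X \<Longrightarrow> y \<sqsubseteq>\<^bsub>M\<^esub> v"
    have hv: "h z \<sqsubseteq>\<^bsub>M\<^esub> v" if "z \<in> X" for z using ub that by simp
    have "f z \<sqsubseteq>\<^bsub>M\<^esub> v" "g z \<sqsubseteq>\<^bsub>M\<^esub> v" if "z \<in> X" for z
      using cpoD(2)[OF M fh hv[OF that]] cpoD(2)[OF M gh hv[OF that]] fM gM hM v XL that by auto
    moreover have "f ` X \<subseteq> carrier M" "g ` X \<subseteq> carrier M" using fM gM XL by auto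
    ultimately have "f x \<sqsubseteq>\<^bsub>M\<^esub> v" "g x \<sqsubseteq>\<^bsub>M\<^esub> v"
      using is_lubD(3)[OF fun_cpoD(3)[OF f X x] _ v] is_lubD(3)[OF fun_cpoD(3)[OF g X x] _ v] by auto
    then show "h x \<sqsubseteq>\<^bsub>M\<^esub> v" using hle[OF xL v] by simp
  qed
  then have "scott_continuous L M h" using hM by (simp add: scott_continuous_def)
  then have hC: "restrict h (carrier L) \<in> carrier (fun_cpo L M)" by (rule restrict_in_fun_cpo)
  have "is_lub (fun_cpo L M) (restrict h (carrier L)) {f, g}"
  proof (rule is_lubI[OF _ hC])
    show "{f, g} \<subseteq> carrier (fun_cpo L M)" using f g by simp
    show "y \<sqsubseteq>\<^bsub>fun_cpo L M\<^esub> restrict h (carrier L)" if "y \<in> {f, g}" for y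
      using that fh gh by (auto simp: fun_cpo_simps)
    fix v assume v: "v \<in> carrier (fun_cpo L M)" and "\<And>y. y \<in> {f, g} \<Longrightarrow> y \<sqsubseteq>\<^bsub>fun_cpo L M\<^esub> v"
    then have "f \<sqsubseteq>\<^bsub>fun_cpo L M\<^esub> v" "g \<sqsubseteq>\<^bsub>fun_cpo L M\<^esub> v" by blast+
    then show "restrict h (carrier L) \<sqsubseteq>\<^bsub>fun_cpo L M\<^esub> v"
      using hle fun_cpoD(2)[OF v] unfolding fun_cpo_simps by simp
  qed
  then show "\<exists>z. is_lub (fun_cpo L M) z {f, g}" by blast
qed

lemma bounded_complete_coded:
  assumes inj: "inj_on (code L) (carrier L)" and bc: "bounded_complete L"
  shows "bounded_complete (coded L)"
  unfolding bounded_complete_def coded_simps(1)[OF inj]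
proof (intro ballI impI; elim imageE; clarify)
  fix x y u assume C: "x \<in> carrier L" "y \<in> carrier L" "u \<in> carrier L"
    and "code L x \<sqsubseteq>\<^bsub>coded L\<^esub> code L u" "code L y \<sqsubseteq>\<^bsub>coded L\<^esub> code L u"
  then obtain z where z: "is_lub L z {x, y}"
    using bc coded_simps(2)[OF inj] unfolding bounded_complete_def by meson
  then show "\<exists>z. is_lub (coded L) z {code L x, code L y}"
    using is_lub_coded[OF inj, of "{x, y}" z] C is_lubD(1)[OF z] by auto
qed

text \<open>In a flat order, two elements with a common upper bound are equal or one of them is
  bottom, so the pair has a greatest member.\<close>

lemma bounded_complete_Nplus: "bounded_complete Nplus"
proof -
  have "is_lub Nplus (if x = None then y else x) {x, y}" if "x \<sqsubseteq>\<^bsub>Nplus\<^esub> u" "y \<sqsubseteq>\<^bsub>Nplus\<^esub> u" for x y u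
    using that by (intro iffD2[OF is_lub_Nplus refl]) auto
  then show ?thesis unfolding bounded_complete_def by blast
qed

lemma bounded_complete_D: "bounded_complete (D n)"
proof (induction n)
  case 0
  show ?case using bounded_complete_coded[OF inj_on_code_D(1) bounded_complete_Nplus] by simp
next
  case (Suc n)
  show ?case
    using bounded_complete_coded[OF inj_on_code_D(2) bounded_complete_fun_cpo[OF cpo_D cpo_D Suc]] by simp
qed

section \<open>Approximation by points of open sets\<close>

text \<open>With its Scott topology such an order is a c-space in the sense of Ern\'e.\<close>

definition c_space :: "('a, 'c) gorder_scheme \<Rightarrow> bool" where
  "c_space L \<longleftrightarrow> (\<forall>U x. scott_open L U \<longrightarrow> x \<in> U \<longrightarrow>
     (\<exists>k\<in>U. \<exists>W. scott_open L W \<and> x \<in> W \<and> (\<forall>y\<in>W. k \<sqsubseteq>\<^bsub>L\<^esub> y)))"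

lemma directed_finite_upper_bound:
  assumes L: "cpo L" and X: "directed L X" and F: "finite F" "F \<subseteq> X"
  shows "\<exists>z\<in>X. \<forall>x\<in>F. x \<sqsubseteq>\<^bsub>L\<^esub> z"
  using F
proof (induction F rule: finite_induct)
  case empty
  then show ?case using X by (auto simp: directed_def)
next
  case (insert a F)
  then obtain z where z: "z \<in> X" "\<forall>x\<in>F. x \<sqsubseteq>\<^bsub>L\<^esub> z" by auto
  obtain w where w: "w \<in> X" "z \<sqsubseteq>\<^bsub>L\<^esub> w" "a \<sqsubseteq>\<^bsub>L\<^esub> w"
    using X z(1) insert.prems unfolding directed_def by (metis insert_subset)
  have "x \<sqsubseteq>\<^bsub>L\<^esub> w" if "x \<in> F" for x
    using cpoD(2)[OF L, of x z w] z w that insert.prems directed_subset[OF X] by auto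
  then show ?case using w by auto
qed

text \<open>Some \<open>e k x\<close> already lies in \<open>U\<close>, and it serves as the
  required point of \<open>U\<close>. Since \<open>e k\<close> has finite image, it sends a directed
  set to one with a greatest element, which makes the condition defining \<open>W\<close>
  open.\<close>

lemma approximation_imp_c_space:
  assumes L: "cpo L" and e: "approximation L e"
  shows "c_space L"
  unfolding c_space_def
proof (intro allI impI)
  fix U x assume U: "scott_open L U" and xU: "x \<in> U"
  have x: "x \<in> carrier L" using scott_openD(1)[OF U] xU by auto
  have eC: "e k \<in> carrier (fun_cpo L L)" and efin: "finite (e k ` carrier L)" for k
    using e by (simp_all add: approximation_def)
  have elub: "directed L (range (\<lambda>k. e k y))" "is_lub L y (range (\<lambda>k. e k y))" if "y \<in> carrier L" for y
    using e that by (simp_all add: approximation_def)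
  obtain k where k: "e k x \<in> U"
    using scott_openD(3)[OF U elub[OF x] xU] by blast
  note eL = fun_cpoD(2)[OF eC]
  \<comment> \<open>The up-set of \<open>e k x\<close> need not be open, as \<open>e k\<close> is
    not assumed idempotent. Comparing with \<open>e k y\<close> instead gives an open set, and it
    still lies above \<open>e k x\<close> because \<open>e k y \<sqsubseteq> y\<close>.\<close>
  define W where "W = {y \<in> carrier L. e k x \<sqsubseteq>\<^bsub>L\<^esub> e k y}"
  have "scott_open L W"
    unfolding scott_open_def
  proof (intro conjI allI impI ballI)
    show "W \<subseteq> carrier L" by (auto simp: W_def)
    show "z \<in> W" if "y \<in> W" "z \<in> carrier L" "y \<sqsubseteq>\<^bsub>L\<^esub> z" for y z
      using that fun_cpo_mono[OF L eC, of y z k] cpoD(2)[OF L, of "e k x" "e k y" "e k z"] eL x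
      by (auto simp: W_def)
    fix Y y assume Y: "directed L Y" and y: "is_lub L y Y" and yW: "y \<in> W"
    have YL: "Y \<subseteq> carrier L" using Y by (rule directed_subset)
    have dir: "directed L (e k ` Y)"
      by (rule scott_continuous_directed[OF L fun_cpo_scott_continuous[OF eC] Y])
    have "finite (e k ` Y)" using efin YL by (meson finite_subset image_mono)
    from directed_finite_upper_bound[OF L dir this order.refl]
    obtain z where z: "z \<in> Y" "\<forall>w\<in>e k ` Y. w \<sqsubseteq>\<^bsub>L\<^esub> e k z" by blast
    have "e k y \<sqsubseteq>\<^bsub>L\<^esub> e k z"
      by (rule is_lubD(3)[OF fun_cpoD(3)[OF eC Y y]]) (use z YL eL in auto)
    then have "z \<in> W"
      using yW z(1) YL cpoD(2)[OF L, of "e k x" "e k y" "e k z"] eL x by (auto simp: W_def)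
    then show "Y \<inter> W \<noteq> {}" using z(1) by blast
  qed
  moreover have "x \<in> W" using x cpoD(1)[OF L] eL by (simp add: W_def)
  moreover have "e k x \<sqsubseteq>\<^bsub>L\<^esub> y" if "y \<in> W" for y
  proof -
    have y: "y \<in> carrier L" "e k x \<sqsubseteq>\<^bsub>L\<^esub> e k y" using that by (auto simp: W_def)
    have "e k y \<sqsubseteq>\<^bsub>L\<^esub> y"
      by (rule is_lubD(2)[OF elub(2)[OF y(1)]]) (use eL y in auto)
    then show ?thesis using cpoD(2)[OF L y(2)] eL x y by blast
  qed
  ultimately show "\<exists>k\<in>U. \<exists>W. scott_open L W \<and> x \<in> W \<and> (\<forall>y\<in>W. k \<sqsubseteq>\<^bsub>L\<^esub> y)"
    using k by blast
qed

lemma c_space_D: "c_space (D n)"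
  using D_cpo_approximation[of n] approximation_imp_c_space by blast

section \<open>The projections $\psi_n$ and embeddings $\phi_n$\<close>

declare D.simps [simp del]

lemma is_lub_unique: "cpo L \<Longrightarrow> is_lub L x X \<Longrightarrow> is_lub L y X \<Longrightarrow> x = y"
  unfolding cpo_def by (meson partial_order.least_unique)

lemma cpo_bottom:
  assumes "cpo L"
  shows "\<bottom>\<^bsub>L\<^esub> \<in> carrier L" and "x \<in> carrier L \<Longrightarrow> \<bottom>\<^bsub>L\<^esub> \<sqsubseteq>\<^bsub>L\<^esub> x"
proof -
  have "least L \<bottom>\<^bsub>L\<^esub> (carrier L)"
    unfolding bottom_def using cpoD(5)[OF assms] by (rule someI_ex)
  then show "\<bottom>\<^bsub>L\<^esub> \<in> carrier L" "x \<in> carrier L \<Longrightarrow> \<bottom>\<^bsub>L\<^esub> \<sqsubseteq>\<^bsub>L\<^esub> x"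
    by (auto simp: least_def)
qed

lemma scott_continuous_code:
  assumes inj: "inj_on (code L) (carrier L)"
  shows "scott_continuous L (coded L) (code L)"
  unfolding scott_continuous_def
proof (intro conjI allI impI)
  show "code L \<in> carrier L \<rightarrow> carrier (coded L)" by (simp add: coded_simps[OF inj])
  show "is_lub (coded L) (code L x) (code L ` X)" if "directed L X" "is_lub L x X" for X x
    using is_lub_coded[OF inj directed_subset[OF that(1)] is_lubD(1)[OF that(2) directed_subset[OF that(1)]]]
      that(2) by simp
qed

lemma scott_continuous_decode:
  assumes inj: "inj_on (code L) (carrier L)"
  shows "scott_continuous (coded L) L (decode L)"
  unfolding scott_continuous_def
proof (intro conjI allI impI)
  show "decode L \<in> carrier (coded L) \<rightarrow> carrier L"
    using coded_simps(1,3)[OF inj] by auto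
  fix Y u assume Y: "directed (coded L) Y" and u: "is_lub (coded L) u Y"
  obtain X where X: "directed L X" "Y = code L ` X"
    using Y directed_coded[OF inj] by metis
  have XL: "X \<subseteq> carrier L" using X(1) by (rule directed_subset)
  obtain x where x: "x \<in> carrier L" "u = code L x"
    using is_lubD(1)[OF u directed_subset[OF Y]] by (auto simp: coded_simps[OF inj])
  have "is_lub L x X" using u is_lub_coded[OF inj XL x(1)] X(2) x(2) by simp
  moreover have "decode L ` Y = X"
    unfolding X(2) image_image using XL coded_simps(3)[OF inj] by (auto simp: subset_iff image_iff)
  ultimately show "is_lub L (decode L u) (decode L ` Y)"
    using x coded_simps(3)[OF inj] by simp
qed

lemma scott_continuous_fn: "scott_continuous (D (Suc n)) (fun_cpo (D n) (D n)) (fn n)"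
  unfolding fn_def D.simps by (rule scott_continuous_decode[OF inj_on_code_D(2)])

lemma scott_continuous_el: "scott_continuous (fun_cpo (D n) (D n)) (D (Suc n)) (el n)"
  unfolding el_def D.simps by (rule scott_continuous_code[OF inj_on_code_D(2)])

lemmas fn_closed = scott_continuousD(1)[OF scott_continuous_fn]
lemmas fn_apply_closed = fun_cpoD(2)[OF fn_closed]

text \<open>One joint induction, since each of \<open>\<phi> (Suc n)\<close> and
  \<open>\<psi> (Suc n)\<close> is built from both \<open>\<phi> n\<close> and
  \<open>\<psi> n\<close>.\<close>

lemma scott_continuous_\<phi>_\<psi>:
  "scott_continuous (D n) (D (Suc n)) (\<phi> n) \<and> scott_continuous (D (Suc n)) (D n) (\<psi> n)"
proof (induction n)
  case 0
  have "scott_continuous (D 0) (fun_cpo (D 0) (D 0)) (\<lambda>d. restrict (\<lambda>x. d) (carrier (D 0)))"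
    by (rule scott_continuous_curry[OF cpo_D cpo_D cpo_D])
      (simp_all add: scott_continuous_const[OF cpo_D cpo_D] scott_continuous_ident)
  then have "scott_continuous (D 0) (D (Suc 0)) (\<lambda>d. el 0 (restrict (\<lambda>x. d) (carrier (D 0))))"
    by (rule scott_continuous_compose[OF cpo_D _ scott_continuous_el])
  moreover have "scott_continuous (D (Suc 0)) (D 0) (\<lambda>g. fn 0 g \<bottom>\<^bsub>D 0\<^esub>)"
    by (rule scott_continuous_compose[OF cpo_D scott_continuous_fn
          scott_continuous_eval[OF cpo_D cpo_D cpo_bottom(1)[OF cpo_D]]])
  ultimately show ?case
    by (auto elim!: scott_continuous_cong)
next
  case (Suc n)
  then have \<phi>: "scott_continuous (D n) (D (Suc n)) (\<phi> n)" and \<psi>: "scott_continuous (D (Suc n)) (D n) (\<psi> n)"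
    by auto
  have "scott_continuous (D (Suc n)) (D (Suc (Suc n)))
      (\<lambda>d. el (Suc n) (\<lambda>x\<in>carrier (D (Suc n)). \<phi> n (fn n d (\<psi> n x))))"
    by (intro scott_continuous_compose[OF cpo_D _ scott_continuous_el]
        scott_continuous_compose[OF cpo_D scott_continuous_fn]
        scott_continuous_conjugate[OF cpo_D cpo_D \<phi> \<psi>])
  moreover have "scott_continuous (D (Suc (Suc n))) (D (Suc n))
      (\<lambda>g. el n (\<lambda>x\<in>carrier (D n). \<psi> n (fn (Suc n) g (\<phi> n x))))"
    by (intro scott_continuous_compose[OF cpo_D _ scott_continuous_el]
        scott_continuous_compose[OF cpo_D scott_continuous_fn]
        scott_continuous_conjugate[OF cpo_D cpo_D \<psi> \<phi>])
  ultimately show ?case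
    by (auto elim!: scott_continuous_cong)
qed

lemmas scott_continuous_\<phi> = scott_continuous_\<phi>_\<psi>[THEN conjunct1]
  and scott_continuous_\<psi> = scott_continuous_\<phi>_\<psi>[THEN conjunct2]
lemmas \<phi>_closed = scott_continuousD(1)[OF scott_continuous_\<phi>]
  and \<psi>_closed = scott_continuousD(1)[OF scott_continuous_\<psi>]
  and \<phi>_mono = scott_continuous_mono[OF cpo_D scott_continuous_\<phi>]
  and \<psi>_mono = scott_continuous_mono[OF cpo_D scott_continuous_\<psi>]

lemma conjugate_in_fun_cpo:
  "d \<in> carrier (D (Suc n)) \<Longrightarrow>
    (\<lambda>x\<in>carrier (D (Suc n)). \<phi> n (fn n d (\<psi> n x))) \<in> carrier (fun_cpo (D (Suc n)) (D (Suc n)))"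
  "g \<in> carrier (D (Suc (Suc n))) \<Longrightarrow>
    (\<lambda>x\<in>carrier (D n). \<psi> n (fn (Suc n) g (\<phi> n x))) \<in> carrier (fun_cpo (D n) (D n))"
  using scott_continuousD(1)[OF scott_continuous_conjugate[OF cpo_D cpo_D scott_continuous_\<phi> scott_continuous_\<psi>] fn_closed]
    scott_continuousD(1)[OF scott_continuous_conjugate[OF cpo_D cpo_D scott_continuous_\<psi> scott_continuous_\<phi>] fn_closed]
  by auto

text \<open>Embedding-projection pairs. At level 0 the inequality says that a monotone map takes its
  least value at bottom. In the step, conjugating back and forth cancels inner and outer composites
  for the equation; for the inequality it shrinks first the argument and then the value, and
  monotonicity of \<open>g\<close> joins the two.\<close>

lemma \<psi>_\<phi>_and_\<phi>_\<psi>: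
  "(\<forall>x\<in>carrier (D n). \<psi> n (\<phi> n x) = x) \<and>
   (\<forall>y\<in>carrier (D (Suc n)). \<phi> n (\<psi> n y) \<sqsubseteq>\<^bsub>D (Suc n)\<^esub> y)"
proof (induction n)
  case 0
  have const: "(\<lambda>x\<in>carrier (D 0). d) \<in> carrier (fun_cpo (D 0) (D 0))" if "d \<in> carrier (D 0)" for d
    by (rule restrict_in_fun_cpo[OF scott_continuous_const[OF cpo_D cpo_D that]])
  have "\<psi> 0 (\<phi> 0 x) = x" if "x \<in> carrier (D 0)" for x
    using cpo_bottom(1)[OF cpo_D] that by (simp add: fn_el[OF const])
  moreover have "\<phi> 0 (\<psi> 0 y) \<sqsubseteq>\<^bsub>D (Suc 0)\<^esub> y" if y: "y \<in> carrier (D (Suc 0))" for y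
  proof -
    have "fn 0 y \<bottom>\<^bsub>D 0\<^esub> \<sqsubseteq>\<^bsub>D 0\<^esub> fn 0 y x" if "x \<in> carrier (D 0)" for x
      using fun_cpo_mono[OF cpo_D fn_closed[OF y]] cpo_bottom[OF cpo_D] that by blast
    then show ?thesis
      using fn_apply_closed[OF y cpo_bottom(1)[OF cpo_D]]
      by (simp add: le_D_Suc fn_el[OF const] fun_cpo_simps)
  qed
  ultimately show ?case by blast
next
  case (Suc n)
  then have \<psi>\<phi>: "\<psi> n (\<phi> n x) = x" if "x \<in> carrier (D n)" for x using that by blast
  have \<phi>\<psi>: "\<phi> n (\<psi> n y) \<sqsubseteq>\<^bsub>D (Suc n)\<^esub> y" if "y \<in> carrier (D (Suc n))" for y using Suc that by blast
  have "\<psi> (Suc n) (\<phi> (Suc n) d) = d" if d: "d \<in> carrier (D (Suc n))" for d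
  proof -
    have "(\<lambda>x\<in>carrier (D n). \<psi> n (fn (Suc n) (\<phi> (Suc n) d) (\<phi> n x))) = (\<lambda>x\<in>carrier (D n). fn n d x)"
      using \<phi>_closed fn_apply_closed[OF d] \<psi>\<phi>
      by (intro restrict_ext) (simp add: fn_el[OF conjugate_in_fun_cpo(1)[OF d]])
    also have "\<dots> = fn n d"
      using fun_cpoD(1)[OF fn_closed[OF d]] by (simp add: PiE_restrict)
    finally show ?thesis using el_fn[OF d] by simp
  qed
  moreover have "\<phi> (Suc n) (\<psi> (Suc n) g) \<sqsubseteq>\<^bsub>D (Suc (Suc n))\<^esub> g" if g: "g \<in> carrier (D (Suc (Suc n)))" for g
  proof -
    have h: "\<psi> (Suc n) g \<in> carrier (D (Suc n))" by (rule \<psi>_closed[OF g])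
    have "\<phi> n (\<psi> n (fn (Suc n) g (\<phi> n (\<psi> n x)))) \<sqsubseteq>\<^bsub>D (Suc n)\<^esub> fn (Suc n) g x"
      if x: "x \<in> carrier (D (Suc n))" for x
    proof -
      have x': "\<phi> n (\<psi> n x) \<in> carrier (D (Suc n))" by (intro \<phi>_closed \<psi>_closed x)
      show ?thesis
        using cpoD(2)[OF cpo_D \<phi>\<psi>[OF fn_apply_closed[OF g x']]
            fun_cpo_mono[OF cpo_D fn_closed[OF g] x' x \<phi>\<psi>[OF x]]]
          fn_apply_closed[OF g x'] fn_apply_closed[OF g x] \<phi>_closed \<psi>_closed by blast
    qed
    moreover have "fn (Suc n) (\<phi> (Suc n) (\<psi> (Suc n) g)) x = \<phi> n (\<psi> n (fn (Suc n) g (\<phi> n (\<psi> n x))))"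
      if "x \<in> carrier (D (Suc n))" for x
    proof -
      have "fn n (\<psi> (Suc n) g) = (\<lambda>x\<in>carrier (D n). \<psi> n (fn (Suc n) g (\<phi> n x)))"
        by (simp add: fn_el[OF conjugate_in_fun_cpo(2)[OF g]])
      then show ?thesis
        using that \<psi>_closed[OF that] fn_el[OF conjugate_in_fun_cpo(1)[OF h]]
        by (simp del: \<psi>.simps)
    qed
    ultimately show ?thesis
      unfolding le_D_Suc[where n = "Suc n"] fun_cpo_simps by simp
  qed
  ultimately show ?case by blast
qed

lemma \<psi>_\<phi>: "x \<in> carrier (D n) \<Longrightarrow> \<psi> n (\<phi> n x) = x"
  and \<phi>_\<psi>_le: "y \<in> carrier (D (Suc n)) \<Longrightarrow> \<phi> n (\<psi> n y) \<sqsubseteq>\<^bsub>D (Suc n)\<^esub> y"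
  using \<psi>_\<phi>_and_\<phi>_\<psi> by blast+

declare \<phi>.simps [simp del] \<psi>.simps [simp del]

text \<open>The Galois connection contained in an embedding-projection pair; it transfers meets from
  one level to the next.\<close>

lemma \<phi>_le_iff:
  assumes x: "x \<in> carrier (D n)" and y: "y \<in> carrier (D (Suc n))"
  shows "\<phi> n x \<sqsubseteq>\<^bsub>D (Suc n)\<^esub> y \<longleftrightarrow> x \<sqsubseteq>\<^bsub>D n\<^esub> \<psi> n y"
proof
  assume "\<phi> n x \<sqsubseteq>\<^bsub>D (Suc n)\<^esub> y"
  then show "x \<sqsubseteq>\<^bsub>D n\<^esub> \<psi> n y"
    using \<psi>_mono[OF \<phi>_closed[OF x] y] \<psi>_\<phi>[OF x] by simp
next
  assume "x \<sqsubseteq>\<^bsub>D n\<^esub> \<psi> n y"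
  then show "\<phi> n x \<sqsubseteq>\<^bsub>D (Suc n)\<^esub> y"
    using cpoD(2)[OF cpo_D \<phi>_mono[OF x \<psi>_closed[OF y]] \<phi>_\<psi>_le[OF y]] \<phi>_closed[OF x]
      \<phi>_closed[OF \<psi>_closed[OF y]] y by blast
qed

section \<open>$D_\infty$\<close>

lemma D_inf_simps:
  "d \<in> carrier D_inf \<longleftrightarrow> (\<forall>n. d n \<in> carrier (D n) \<and> \<psi> n (d (Suc n)) = d n)"
  "eq D_inf = (=)"
  "d \<sqsubseteq>\<^bsub>D_inf\<^esub> e \<longleftrightarrow> (\<forall>n. d n \<sqsubseteq>\<^bsub>D n\<^esub> e n)"
  by (simp_all add: D_inf_def)

lemma D_inf_proj_closed: "d \<in> carrier D_inf \<Longrightarrow> d n \<in> carrier (D n)"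
  and D_inf_\<psi>: "d \<in> carrier D_inf \<Longrightarrow> \<psi> n (d (Suc n)) = d n"
  by (simp_all add: D_inf_simps)

lemma \<phi>_D_inf_le: "d \<in> carrier D_inf \<Longrightarrow> \<phi> n (d n) \<sqsubseteq>\<^bsub>D (Suc n)\<^esub> d (Suc n)"
  using \<phi>_\<psi>_le[of "d (Suc n)" n] by (simp add: D_inf_simps)

lemma is_lub_D_infI:
  assumes X: "X \<subseteq> carrier D_inf" and d: "d \<in> carrier D_inf"
    and lub: "\<And>n. is_lub (D n) (d n) ((\<lambda>x. x n) ` X)"
  shows "is_lub D_inf d X"
proof (rule is_lubI[OF X d])
  have sub: "(\<lambda>x. x n) ` X \<subseteq> carrier (D n)" for n
    using X D_inf_proj_closed by (intro image_subsetI) (meson subsetD)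
  show "x \<sqsubseteq>\<^bsub>D_inf\<^esub> d" if "x \<in> X" for x
    using is_lubD(2)[OF lub sub imageI[OF that]] by (simp add: D_inf_simps)
  show "d \<sqsubseteq>\<^bsub>D_inf\<^esub> u" if u: "u \<in> carrier D_inf" and le: "\<And>x. x \<in> X \<Longrightarrow> x \<sqsubseteq>\<^bsub>D_inf\<^esub> u" for u
    unfolding D_inf_simps
  proof
    fix n
    show "d n \<sqsubseteq>\<^bsub>D n\<^esub> u n"
      by (rule is_lubD(3)[OF lub sub D_inf_proj_closed[OF u]])
        (use le in \<open>auto simp: D_inf_simps\<close>)
  qed
qed

text \<open>The componentwise sups form a compatible sequence because every \<open>\<psi> n\<close>
  preserves directed sups.\<close>

lemma D_inf_lub:
  assumes X: "directed D_inf X"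
  obtains d where "is_lub D_inf d X" and "\<And>n. is_lub (D n) (d n) ((\<lambda>x. x n) ` X)"
proof -
  have XC: "x \<in> carrier D_inf" if "x \<in> X" for x using directed_subset[OF X] that by auto
  have dir: "directed (D n) ((\<lambda>x. x n) ` X)" for n
    by (rule directed_image[OF X]) (use XC in \<open>auto simp: D_inf_simps\<close>)
  then have "\<exists>y. is_lub (D n) y ((\<lambda>x. x n) ` X)" for n by (rule cpoD(4)[OF cpo_D])
  then obtain d where d: "\<And>n. is_lub (D n) (d n) ((\<lambda>x. x n) ` X)" by metis
  have "\<psi> n (d (Suc n)) = d n" for n
  proof (rule is_lub_unique[OF cpo_D _ d])
    have "\<psi> n ` (\<lambda>x. x (Suc n)) ` X = (\<lambda>x. x n) ` X"
      unfolding image_image using XC by (intro image_cong) (simp_all add: D_inf_\<psi>)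
    then show "is_lub (D n) (\<psi> n (d (Suc n))) ((\<lambda>x. x n) ` X)"
      using scott_continuousD(2)[OF scott_continuous_\<psi> dir d, of n] by simp
  qed
  then have "d \<in> carrier D_inf"
    using is_lubD(1)[OF d directed_subset[OF dir]] by (simp add: D_inf_simps)
  then show ?thesis
    using that[OF is_lub_D_infI[OF directed_subset[OF X] _ d] d] by blast
qed

lemma cpo_D_inf: "cpo D_inf"
proof (rule cpoI[where b = "\<lambda>n. \<bottom>\<^bsub>D n\<^esub>"])
  show "\<exists>x. is_lub D_inf x X" if "directed D_inf X" for X
    using D_inf_lub[OF that] by blast
  show "x \<sqsubseteq>\<^bsub>D_inf\<^esub> x" if "x \<in> carrier D_inf" for x
    using that cpoD(1)[OF cpo_D] by (simp add: D_inf_simps)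
  show "x \<sqsubseteq>\<^bsub>D_inf\<^esub> z" if "x \<sqsubseteq>\<^bsub>D_inf\<^esub> y" "y \<sqsubseteq>\<^bsub>D_inf\<^esub> z"
    "x \<in> carrier D_inf" "y \<in> carrier D_inf" "z \<in> carrier D_inf" for x y z
    using that cpoD(2)[OF cpo_D] unfolding D_inf_simps by meson
  show "x = y" if "x \<sqsubseteq>\<^bsub>D_inf\<^esub> y" "y \<sqsubseteq>\<^bsub>D_inf\<^esub> x" "x \<in> carrier D_inf" "y \<in> carrier D_inf" for x y
    using that cpoD(3)[OF cpo_D] unfolding D_inf_simps by (intro ext) blast
  show "(\<lambda>n. \<bottom>\<^bsub>D n\<^esub>) \<sqsubseteq>\<^bsub>D_inf\<^esub> x" if "x \<in> carrier D_inf" for x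
    using that cpo_bottom(2)[OF cpo_D] by (simp add: D_inf_simps)
  \<comment> \<open>The sequence of bottoms is compatible because \<open>\<psi> n\<close> is strict:
    bottom lies below \<open>\<phi> n\<close> of bottom, and applying \<open>\<psi> n\<close> to the
    latter gives bottom again.\<close>
  note bot = cpo_bottom(1)[OF cpo_D]
  have "\<psi> n \<bottom>\<^bsub>D (Suc n)\<^esub> \<sqsubseteq>\<^bsub>D n\<^esub> \<bottom>\<^bsub>D n\<^esub>" for n
    using \<psi>_mono[OF bot \<phi>_closed[OF bot] cpo_bottom(2)[OF cpo_D \<phi>_closed[OF bot]]] \<psi>_\<phi>[OF bot] by simp
  then have "\<psi> n \<bottom>\<^bsub>D (Suc n)\<^esub> = \<bottom>\<^bsub>D n\<^esub>" for n
    using cpoD(3)[OF cpo_D _ cpo_bottom(2)[OF cpo_D]] \<psi>_closed[OF bot] bot by blast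
  then show "(\<lambda>n. \<bottom>\<^bsub>D n\<^esub>) \<in> carrier D_inf"
    using bot by (simp add: D_inf_simps)
qed (simp add: D_inf_simps)

lemma scott_continuous_D_inf_proj: "scott_continuous D_inf (D n) (\<lambda>d. d n)"
  unfolding scott_continuous_def
proof (intro conjI allI impI)
  show "(\<lambda>d. d n) \<in> carrier D_inf \<rightarrow> carrier (D n)" by (simp add: D_inf_proj_closed)
  fix X x assume X: "directed D_inf X" and x: "is_lub D_inf x X"
  show "is_lub (D n) (x n) ((\<lambda>d. d n) ` X)"
    using D_inf_lub[OF X] is_lub_unique[OF cpo_D_inf x] by metis
qed

lemma scott_continuous_D_infI:
  assumes L: "cpo L" and C: "\<And>x. x \<in> carrier L \<Longrightarrow> f x \<in> carrier D_inf"
    and f: "\<And>n. scott_continuous L (D n) (\<lambda>x. f x n)"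
  shows "scott_continuous L D_inf f"
  unfolding scott_continuous_def
proof (intro conjI allI impI)
  show "f \<in> carrier L \<rightarrow> carrier D_inf" using C by simp
  fix X x assume X: "directed L X" and x: "is_lub L x X"
  have XL: "X \<subseteq> carrier L" using X by (rule directed_subset)
  show "is_lub D_inf (f x) (f ` X)"
  proof (rule is_lub_D_infI)
    show "f ` X \<subseteq> carrier D_inf" "f x \<in> carrier D_inf"
      using C XL is_lubD(1)[OF x XL] by auto
    show "is_lub (D n) (f x n) ((\<lambda>x. x n) ` f ` X)" for n
      using scott_continuousD(2)[OF f X x] by (simp add: image_image)
  qed
qed

lemma D_inf_meet:
  assumes x: "x \<in> carrier D_inf" and y: "y \<in> carrier D_inf"
  shows "\<exists>m. is_meet D_inf x y m"
proof -
  obtain m where m: "\<And>n. is_meet (D n) (x n) (y n) (m n)"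
    using bounded_complete_meet[OF cpo_D bounded_complete_D D_inf_proj_closed[OF x] D_inf_proj_closed[OF y]]
    by metis
  have mC: "m n \<in> carrier (D n)"
    and le_m: "z \<in> carrier (D n) \<Longrightarrow> z \<sqsubseteq>\<^bsub>D n\<^esub> m n \<longleftrightarrow> z \<sqsubseteq>\<^bsub>D n\<^esub> x n \<and> z \<sqsubseteq>\<^bsub>D n\<^esub> y n" for z n
    using m by (auto simp: is_meet_def)
  \<comment> \<open>Being an upper adjoint of \<open>\<phi> n\<close>, the map \<open>\<psi> n\<close> preserves meets.\<close>
  have "z \<sqsubseteq>\<^bsub>D n\<^esub> \<psi> n (m (Suc n)) \<longleftrightarrow> z \<sqsubseteq>\<^bsub>D n\<^esub> m n" if z: "z \<in> carrier (D n)" for z n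
    using \<phi>_le_iff[OF z mC] \<phi>_le_iff[OF z D_inf_proj_closed[OF x]] \<phi>_le_iff[OF z D_inf_proj_closed[OF y]]
      le_m[OF \<phi>_closed[OF z]] le_m[OF z] D_inf_\<psi>[OF x] D_inf_\<psi>[OF y] by metis
  \<comment> \<open>Two elements with the same lower bounds lie below each other.\<close>
  then have "\<psi> n (m (Suc n)) = m n" for n
    using cpoD(3)[OF cpo_D] cpoD(1)[OF cpo_D] \<psi>_closed[OF mC] mC by metis
  then have "m \<in> carrier D_inf" using mC by (simp add: D_inf_simps)
  moreover have "z \<sqsubseteq>\<^bsub>D_inf\<^esub> m \<longleftrightarrow> z \<sqsubseteq>\<^bsub>D_inf\<^esub> x \<and> z \<sqsubseteq>\<^bsub>D_inf\<^esub> y" if "z \<in> carrier D_inf" for z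
    using le_m[OF D_inf_proj_closed[OF that]] unfolding D_inf_simps by blast
  ultimately show ?thesis unfolding is_meet_def by blast
qed

section \<open>Embeddings of D_n into D_inf and the approximations they give\<close>

text \<open>\<open>down n x m\<close> is \<open>(\<psi> m \<circ> \<dots> \<circ> \<psi> (n - 1)) x\<close> if $m \le n$, and the junk value \<open>x\<close>
  otherwise; \<open>emb n x\<close> is the image of \<open>x\<close> under the embedding of $D_n$ into $D_\infty$.\<close>

primrec down :: "nat \<Rightarrow> code \<Rightarrow> nat \<Rightarrow> code" where
  "down 0 x = (\<lambda>m. x)"
| "down (Suc n) x = (\<lambda>m. if m \<le> n then down n (\<psi> n x) m else x)"

primrec emb :: "nat \<Rightarrow> code \<Rightarrow> nat \<Rightarrow> code" where
  "emb n x 0 = down n x 0"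
| "emb n x (Suc m) = (if m < n then down n x (Suc m) else \<phi> m (emb n x m))"

lemma down_self: "down n x n = x"
  by (cases n) auto

lemma emb_down: "m \<le> n \<Longrightarrow> emb n x m = down n x m"
  by (cases m) auto

lemma \<psi>_down: "m < n \<Longrightarrow> \<psi> m (down n x (Suc m)) = down n x m"
  by (induction n arbitrary: x) (auto simp: less_Suc_eq down_self)

lemma scott_continuous_down: "m \<le> n \<Longrightarrow> scott_continuous (D n) (D m) (\<lambda>x. down n x m)"
proof (induction n)
  case (Suc n)
  then show ?case
    using scott_continuous_compose[OF cpo_D scott_continuous_\<psi>, of n "D m" "\<lambda>x. down n x m"]
    by (cases "m = Suc n") (simp_all add: scott_continuous_ident)
qed (simp add: scott_continuous_ident)

lemma scott_continuous_emb_proj: "scott_continuous (D n) (D m) (\<lambda>x. emb n x m)"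
proof (induction m)
  case (Suc m)
  then show ?case
    using scott_continuous_compose[OF cpo_D Suc scott_continuous_\<phi>] scott_continuous_down[of "Suc m" n]
    by (cases "m < n") simp_all
qed (simp add: scott_continuous_down)

text \<open>Compatibility holds by construction below level \<open>n\<close>; from \<open>n\<close>
  on it is \<open>\<psi> m (\<phi> m y) = y\<close>.\<close>

lemma emb_closed:
  assumes x: "x \<in> carrier (D n)"
  shows "emb n x \<in> carrier D_inf"
proof -
  note C = scott_continuousD(1)[OF scott_continuous_emb_proj x]
  have "\<psi> m (emb n x (Suc m)) = emb n x m" for m
    using \<psi>_\<phi>[OF C] by (simp add: \<psi>_down emb_down)
  then show ?thesis using C by (simp add: D_inf_simps)
qed

lemma scott_continuous_emb: "scott_continuous (D n) D_inf (emb n)"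
  by (rule scott_continuous_D_infI[OF cpo_D emb_closed scott_continuous_emb_proj])

lemma down_D_inf: "d \<in> carrier D_inf \<Longrightarrow> m \<le> n \<Longrightarrow> down n (d n) m = d m"
  by (induction n) (auto simp: D_inf_\<psi> le_Suc_eq)

lemma emb_proj_eq: "d \<in> carrier D_inf \<Longrightarrow> m \<le> n \<Longrightarrow> emb n (d n) m = d m"
  by (simp add: emb_down down_D_inf)

text \<open>Up to its own level, \<open>emb k (d k)\<close> agrees with \<open>d\<close>; beyond it,
  components arise by applying \<open>\<phi> m\<close>, which stays below \<open>d\<close> because
  \<open>\<phi> m (d m) \<sqsubseteq> d (Suc m)\<close>. A higher level therefore follows
  \<open>d\<close> for longer.\<close>

lemma emb_proj_mono:
  assumes d: "d \<in> carrier D_inf" and "k \<le> n"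
  shows "emb k (d k) \<sqsubseteq>\<^bsub>D_inf\<^esub> emb n (d n)"
proof -
  have C: "emb j (d j) i \<in> carrier (D i)" for i j
    using D_inf_proj_closed[OF emb_closed[OF D_inf_proj_closed[OF d]]] .
  have "emb k (d k) m \<sqsubseteq>\<^bsub>D m\<^esub> emb n (d n) m" for m
  proof (induction m)
    case 0
    show ?case
      using emb_proj_eq[OF d] cpoD(1)[OF cpo_D D_inf_proj_closed[OF d]] by (simp del: emb.simps)
  next
    case (Suc m)
    \<comment> \<open>Component \<open>Suc m\<close> agrees with \<open>d\<close> on both sides, or
      only on the right, or both sides arise by \<open>\<phi> m\<close> from component
      \<open>m\<close>.\<close>
    consider "Suc m \<le> k" | "k \<le> m" "Suc m \<le> n" | "n \<le> m" using \<open>k \<le> n\<close> by linarith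
    then show ?case
    proof cases
      case 1
      then show ?thesis
        using emb_proj_eq[OF d] \<open>k \<le> n\<close> cpoD(1)[OF cpo_D D_inf_proj_closed[OF d]]
        by (simp del: emb.simps)
    next
      case 2
      then have "emb n (d n) m = d m" "emb n (d n) (Suc m) = d (Suc m)"
        using emb_proj_eq[OF d] by (simp_all del: emb.simps)
      moreover have "emb k (d k) (Suc m) = \<phi> m (emb k (d k) m)" using 2 by simp
      ultimately show ?thesis
        using \<phi>_mono[OF C D_inf_proj_closed[OF d]] Suc \<phi>_D_inf_le[OF d]
          cpoD(2)[OF cpo_D _ _ \<phi>_closed[OF C] \<phi>_closed[OF D_inf_proj_closed[OF d]] D_inf_proj_closed[OF d]]
        by metis
    next
      case 3
      then show ?thesis using \<phi>_mono[OF C C Suc] \<open>k \<le> n\<close> by simp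
    qed
  qed
  then show ?thesis by (simp add: D_inf_simps)
qed

lemma emb_proj_le:
  assumes d: "d \<in> carrier D_inf"
  shows "emb n (d n) \<sqsubseteq>\<^bsub>D_inf\<^esub> d"
  unfolding D_inf_simps
proof
  fix m
  \<comment> \<open>Level \<open>max m n\<close> is at least \<open>n\<close>, so the approximation
    only grows, and at least \<open>m\<close>, so its component \<open>m\<close> is exactly
    \<open>d m\<close>.\<close>
  have "emb n (d n) m \<sqsubseteq>\<^bsub>D m\<^esub> emb (max m n) (d (max m n)) m"
    using emb_proj_mono[OF d, of n "max m n"] by (simp add: D_inf_simps)
  then show "emb n (d n) m \<sqsubseteq>\<^bsub>D m\<^esub> d m" by (simp add: emb_proj_eq[OF d])
qed

lemma directed_emb_proj:
  assumes d: "d \<in> carrier D_inf"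
  shows "directed D_inf (range (\<lambda>n. emb n (d n)))"
  unfolding directed_def
proof (intro conjI ballI)
  show "range (\<lambda>n. emb n (d n)) \<subseteq> carrier D_inf"
    using emb_closed[OF D_inf_proj_closed[OF d]] by auto
  fix u v assume "u \<in> range (\<lambda>n. emb n (d n))" "v \<in> range (\<lambda>n. emb n (d n))"
  then obtain j k where uv: "u = emb j (d j)" "v = emb k (d k)" by blast
  show "\<exists>w\<in>range (\<lambda>n. emb n (d n)). u \<sqsubseteq>\<^bsub>D_inf\<^esub> w \<and> v \<sqsubseteq>\<^bsub>D_inf\<^esub> w"
    unfolding uv by (rule bexI[of _ "emb (max j k) (d (max j k))"]) (auto intro!: emb_proj_mono[OF d])
qed simp

text \<open>Component \<open>n\<close> of the \<open>n\<close>-th approximation is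
  \<open>d n\<close> itself, so an upper bound of all approximations dominates \<open>d\<close> in
  every component.\<close>

lemma is_lub_emb_proj:
  assumes d: "d \<in> carrier D_inf"
  shows "is_lub D_inf d (range (\<lambda>n. emb n (d n)))"
proof (rule is_lubI[OF directed_subset[OF directed_emb_proj[OF d]] d])
  show "y \<sqsubseteq>\<^bsub>D_inf\<^esub> d" if "y \<in> range (\<lambda>n. emb n (d n))" for y
    using that emb_proj_le[OF d] by auto
  show "d \<sqsubseteq>\<^bsub>D_inf\<^esub> u" if "\<And>y. y \<in> range (\<lambda>n. emb n (d n)) \<Longrightarrow> y \<sqsubseteq>\<^bsub>D_inf\<^esub> u" for u
    unfolding D_inf_simps
  proof
    fix n
    have "emb n (d n) \<sqsubseteq>\<^bsub>D_inf\<^esub> u" using that by blast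
    then show "d n \<sqsubseteq>\<^bsub>D n\<^esub> u n"
      using emb_proj_eq[OF d order.refl] unfolding D_inf_simps by metis
  qed
qed

text \<open>Some approximation \<open>emb n (x n)\<close> lies in \<open>U\<close>, which moves the
  problem to the preimage of \<open>U\<close> in \<open>D n\<close>. The point \<open>k\<close>
  found there is sent back by \<open>emb n\<close>, and its neighbourhood \<open>W\<close> is pulled
  back along the projection; \<open>emb n k \<sqsubseteq> emb n (y n) \<sqsubseteq> y\<close> gives
  the bound.\<close>

lemma c_space_D_inf: "c_space D_inf"
  unfolding c_space_def
proof (intro allI impI)
  fix U x assume U: "scott_open D_inf U" and xU: "x \<in> U"
  have x: "x \<in> carrier D_inf" using scott_openD(1)[OF U] xU by auto
  obtain n where n: "emb n (x n) \<in> U"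
    using scott_openD(3)[OF U directed_emb_proj[OF x] is_lub_emb_proj[OF x] xU] by blast
  have "scott_open (D n) {y \<in> carrier (D n). emb n y \<in> U}"
    by (rule scott_open_vimage[OF cpo_D scott_continuous_emb U])
  moreover have "x n \<in> {y \<in> carrier (D n). emb n y \<in> U}"
    using n D_inf_proj_closed[OF x] by simp
  ultimately obtain k W where k: "k \<in> carrier (D n)" "emb n k \<in> U"
    and W: "scott_open (D n) W" "x n \<in> W" "\<And>y. y \<in> W \<Longrightarrow> k \<sqsubseteq>\<^bsub>D n\<^esub> y"
    using c_space_D unfolding c_space_def by (metis (mono_tags, lifting) mem_Collect_eq)
  let ?V = "{y \<in> carrier D_inf. y n \<in> W}"
  have "scott_open D_inf ?V"
    by (rule scott_open_vimage[OF cpo_D_inf scott_continuous_D_inf_proj W(1)])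
  moreover have "emb n k \<sqsubseteq>\<^bsub>D_inf\<^esub> y" if "y \<in> ?V" for y
  proof -
    have y: "y \<in> carrier D_inf" "k \<sqsubseteq>\<^bsub>D n\<^esub> y n" using that W(3) by auto
    show ?thesis
      using cpoD(2)[OF cpo_D_inf scott_continuous_mono[OF cpo_D scott_continuous_emb k(1) D_inf_proj_closed[OF y(1)] y(2)]
          emb_proj_le[OF y(1)]] emb_closed k(1) D_inf_proj_closed[OF y(1)] y(1) by blast
  qed
  ultimately show "\<exists>k\<in>U. \<exists>W. scott_open D_inf W \<and> x \<in> W \<and> (\<forall>y\<in>W. k \<sqsubseteq>\<^bsub>D_inf\<^esub> y)"
    using k(2) x W(2) by blast
qed

section \<open>The homotopy\<close>

text \<open>Near \<open>t\<close>, both \<open>p\<close> and \<open>q\<close> stay in a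
  neighbourhood \<open>W\<close> of \<open>m t\<close> that lies above some \<open>k\<close> in
  \<open>U\<close>. Their meet then stays above \<open>k\<close>, hence in \<open>U\<close>.\<close>

lemma continuous_map_meet:
  assumes L: "c_space L"
    and p: "continuous_map X (scott_topology L) p" and q: "continuous_map X (scott_topology L) q"
    and m: "\<And>t. t \<in> topspace X \<Longrightarrow> is_meet L (p t) (q t) (m t)"
    and refl: "\<And>x. x \<in> carrier L \<Longrightarrow> x \<sqsubseteq>\<^bsub>L\<^esub> x"
  shows "continuous_map X (scott_topology L) m"
  unfolding continuous_map_def
proof (intro conjI allI impI)
  have mC: "m t \<in> carrier L" and mp: "m t \<sqsubseteq>\<^bsub>L\<^esub> p t" and mq: "m t \<sqsubseteq>\<^bsub>L\<^esub> q t"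
    and le_m: "k \<in> carrier L \<Longrightarrow> k \<sqsubseteq>\<^bsub>L\<^esub> p t \<Longrightarrow> k \<sqsubseteq>\<^bsub>L\<^esub> q t \<Longrightarrow> k \<sqsubseteq>\<^bsub>L\<^esub> m t" if "t \<in> topspace X" for t k
    using m[OF that] refl by (auto simp: is_meet_def)
  have pC: "p t \<in> carrier L" and qC: "q t \<in> carrier L" if "t \<in> topspace X" for t
    using continuous_map_image_subset_topspace[OF p] continuous_map_image_subset_topspace[OF q] that by auto
  show "m \<in> topspace X \<rightarrow> topspace (scott_topology L)" using mC by simp
  fix U assume "openin (scott_topology L) U"
  then have U: "scott_open L U" by simp
  show "openin X {t \<in> topspace X. m t \<in> U}"
  proof (subst openin_subopen, intro ballI)
    fix t assume t: "t \<in> {t \<in> topspace X. m t \<in> U}"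
    then obtain k W where k: "k \<in> U" and W: "scott_open L W" "m t \<in> W" "\<And>y. y \<in> W \<Longrightarrow> k \<sqsubseteq>\<^bsub>L\<^esub> y"
      using L U unfolding c_space_def by (metis (mono_tags, lifting) mem_Collect_eq)
    have kC: "k \<in> carrier L" using k scott_openD(1)[OF U] by auto
    let ?V = "{t \<in> topspace X. p t \<in> W} \<inter> {t \<in> topspace X. q t \<in> W}"
    have "openin X ?V"
      using W(1) by (intro openin_Int openin_continuous_map_preimage[OF p] openin_continuous_map_preimage[OF q]) simp_all
    moreover have "t \<in> ?V"
      using t W(2) scott_openD(2)[OF W(1)] mp mq pC qC by blast
    moreover have "?V \<subseteq> {t \<in> topspace X. m t \<in> U}"
      using W(3) le_m[OF _ kC] scott_openD(2)[OF U k mC] by blast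
    ultimately show "\<exists>T. openin X T \<and> t \<in> T \<and> T \<subseteq> {t \<in> topspace X. m t \<in> U}" by blast
  qed
qed

text \<open>The assumption \<open>special\<close> says that \<open>h t\<close> lies below
  \<open>f t\<close> and \<open>g t\<close> in the specialization preorder of \<open>Y\<close>. A
  value at the seam may thus jump downwards without losing continuity.\<close>

lemma continuous_map_glue_at:
  fixes c :: real
  assumes s: "continuous_map X euclideanreal s"
    and f: "continuous_map X Y f" and g: "continuous_map X Y g" and h: "continuous_map X Y h"
    and special: "\<And>U t. openin Y U \<Longrightarrow> t \<in> topspace X \<Longrightarrow> h t \<in> U \<Longrightarrow> f t \<in> U \<and> g t \<in> U"
  shows "continuous_map X Y (\<lambda>t. if s t < c then f t else if c < s t then g t else h t)"
    (is "continuous_map X Y ?F")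
  unfolding continuous_map_def
proof (intro conjI allI impI)
  show "?F \<in> topspace X \<rightarrow> topspace Y"
    using f g h by (auto simp: continuous_map_def)
  fix U assume U: "openin Y U"
  have "openin X {t \<in> topspace X. s t \<in> {..<c}}" "openin X {t \<in> topspace X. s t \<in> {c<..}}"
    by (intro openin_continuous_map_preimage[OF s]; simp)+
  \<comment> \<open>The third set is not cut down to \<open>s t = c\<close>, which would spoil
    openness; by \<open>special\<close> its points off the seam belong to the preimage
    anyway.\<close>
  then have "openin X ({t \<in> topspace X. s t \<in> {..<c}} \<inter> {t \<in> topspace X. f t \<in> U} \<union>
      {t \<in> topspace X. s t \<in> {c<..}} \<inter> {t \<in> topspace X. g t \<in> U} \<union> {t \<in> topspace X. h t \<in> U})"
    by (intro openin_Un openin_Int openin_continuous_map_preimage[OF f U]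
        openin_continuous_map_preimage[OF g U] openin_continuous_map_preimage[OF h U])
  also have "\<dots> = {t \<in> topspace X. ?F t \<in> U}"
    using special[OF U] by auto
  finally show "openin X {t \<in> topspace X. ?F t \<in> U}" .
qed

section \<open>Coordinates of the cube and the homotopy between n-paths\<close>

lemma topspace_cube: "topspace (cube n) = (\<Pi>\<^sub>E i\<in>{1..n}. {0..1})"
  by (simp add: cube_def)

lemma continuous_map_cube_component:
  assumes "i \<in> {1..n}"
  shows "continuous_map (cube n) (top_of_set {0..1}) (\<lambda>t. t i)"
  unfolding cube_def using continuous_map_product_projection[OF assms] by fastforce

text \<open>The homotopy parameter is the first coordinate, so forgetting it shifts all indices by
  one, matching the renumbering in \<open>fix_vars\<close>.\<close>

definition cube_tail :: "nat \<Rightarrow> (nat \<Rightarrow> real) \<Rightarrow> nat \<Rightarrow> real" where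
  "cube_tail n t = (\<lambda>i\<in>{1..n}. t (Suc i))"

lemma continuous_map_cube_tail: "continuous_map (cube (Suc n)) (cube n) (cube_tail n)"
proof -
  have "continuous_map (cube (Suc n)) (top_of_set {0..1}) (\<lambda>t. cube_tail n t i)" if "i \<in> {1..n}" for i
    using continuous_map_cube_component[of "Suc i" "Suc n"] that by (simp add: cube_tail_def)
  then show ?thesis
    by (subst (2) cube_def) (auto simp: continuous_map_componentwise cube_tail_def)
qed

lemma npath_homotopic_of_meets:
  assumes L: "cpo L" "c_space L"
    and meet: "\<And>x y. x \<in> carrier L \<Longrightarrow> y \<in> carrier L \<Longrightarrow> \<exists>m. is_meet L x y m"
    and p: "npath (scott_topology L) n a b p" and q: "npath (scott_topology L) n a b q"
  shows "npath_homotopic (scott_topology L) n a b p q"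
proof -
  have n: "n \<ge> 1" using p by (simp add: npath_def)
  have pc: "continuous_map (cube n) (scott_topology L) p" and qc: "continuous_map (cube n) (scott_topology L) q"
    using p q by (simp_all add: npath_def)
  have pC: "p t \<in> carrier L" and qC: "q t \<in> carrier L" if "t \<in> topspace (cube n)" for t
    using continuous_map_image_subset_topspace[OF pc] continuous_map_image_subset_topspace[OF qc] that by auto
  define m where "m t = (SOME m. is_meet L (p t) (q t) m)" for t
  have m: "is_meet L (p t) (q t) (m t)" if "t \<in> topspace (cube n)" for t
    unfolding m_def using meet[OF pC qC] that by (intro someI_ex[of "is_meet L (p t) (q t)"])
  have mc: "continuous_map (cube n) (scott_topology L) m"
    by (rule continuous_map_meet[OF L(2) pc qc m cpoD(1)[OF L(1)]])
  have m_le: "m t \<sqsubseteq>\<^bsub>L\<^esub> p t" "m t \<sqsubseteq>\<^bsub>L\<^esub> q t" and mC: "m t \<in> carrier L" if "t \<in> topspace (cube n)" for t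
    using m[OF that] cpoD(1)[OF L(1)] by (auto simp: is_meet_def)
  have m_eq: "m t = p t" if t: "t \<in> topspace (cube n)" and eq: "p t = q t" for t
  proof (rule cpoD(3)[OF L(1) m_le(1)[OF t] _ mC[OF t] pC[OF t]])
    show "p t \<sqsubseteq>\<^bsub>L\<^esub> m t"
      using m[OF t] eq pC[OF t] cpoD(1)[OF L(1)] by (simp add: is_meet_def)
  qed
  \<comment> \<open>The seam 1/2 could be any number strictly between 0 and 1, so that the faces
    \<open>t 1 = 0\<close> and \<open>t 1 = 1\<close> fall into the branches of \<open>p\<close> and
    \<open>q\<close>.\<close>
  define P where
    "P t = (if t 1 < 1/2 then p (cube_tail n t) else if 1/2 < t 1 then q (cube_tail n t) else m (cube_tail n t))"
    for t
  note tail = continuous_map_cube_tail[of n]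
  have tail_in: "cube_tail n t \<in> topspace (cube n)" if "t \<in> topspace (cube (Suc n))" for t
    using continuous_map_image_subset_topspace[OF tail] that by auto
  have "continuous_map (cube (Suc n)) euclideanreal (\<lambda>t. t 1)"
    using continuous_map_cube_component[of 1 "Suc n"] by (simp add: continuous_map_in_subtopology)
  then have "continuous_map (cube (Suc n)) (scott_topology L)
      (\<lambda>t. if t 1 < 1/2 then p (cube_tail n t) else if 1/2 < t 1 then q (cube_tail n t) else m (cube_tail n t))"
  proof (rule continuous_map_glue_at)
    show "continuous_map (cube (Suc n)) (scott_topology L) (\<lambda>t. p (cube_tail n t))"
      "continuous_map (cube (Suc n)) (scott_topology L) (\<lambda>t. q (cube_tail n t))"
      "continuous_map (cube (Suc n)) (scott_topology L) (\<lambda>t. m (cube_tail n t))"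
      using continuous_map_compose[OF tail pc] continuous_map_compose[OF tail qc]
        continuous_map_compose[OF tail mc] by (simp_all add: o_def)
    show "p (cube_tail n t) \<in> U \<and> q (cube_tail n t) \<in> U"
      if "openin (scott_topology L) U" "t \<in> topspace (cube (Suc n))" "m (cube_tail n t) \<in> U" for U t
    proof -
      have "scott_open L U" using that(1) by simp
      then show ?thesis
        using scott_openD(2)[OF _ that(3)] m_le pC qC tail_in[OF that(2)] by blast
    qed
  qed
  then have Pc: "continuous_map (cube (Suc n)) (scott_topology L) P" by (simp add: P_def[abs_def])
  \<comment> \<open>On a face where the last coordinate is 0 or 1, \<open>p\<close> and
    \<open>q\<close> take the same value, so all three branches agree, the middle one by
    \<open>m_eq\<close>.\<close>
  have "P t = c" if t: "t \<in> topspace (cube (Suc n))" and c: "p (cube_tail n t) = c" "q (cube_tail n t) = c" for t c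
    using m_eq[OF tail_in[OF t]] c by (simp add: P_def)
  \<comment> \<open>Since \<open>n \<ge> 1\<close>, the index \<open>n\<close> lies in
    \<open>{1..n}\<close>; otherwise \<open>restrict\<close> would return
    \<open>undefined\<close>.\<close>
  moreover have "cube_tail n t n = t (Suc n)" for t
    using n by (simp add: cube_tail_def)
  ultimately have "npath (scott_topology L) (Suc n) a b P"
    using Pc p q tail_in unfolding npath_def by simp
  moreover have "fix_vars (n + 1) [0] P t = p t \<and> fix_vars (n + 1) [1] P t = q t" if t: "t \<in> topspace (cube n)" for t
  proof -
    \<comment> \<open>Fixing one variable inserts \<open>c\<close> as first coordinate and shifts
      \<open>t\<close> up; the tail undoes the shift.\<close>
    have "cube_tail n (\<lambda>i\<in>{1..n + 1}. if i \<le> length [c] then [c] ! (i - 1) else t (i - length [c])) = t"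
      for c :: real
      using t unfolding topspace_cube
      by (intro extensionalityI[of _ "{1..n}"]) (auto simp: cube_tail_def PiE_def)
    then show ?thesis by (simp add: fix_vars_def P_def)
  qed
  ultimately show ?thesis
    using p q unfolding npath_homotopic_def by auto
qed

theorem corollary4p1:
  fixes n :: nat and a b :: "nat \<Rightarrow> code" and p q :: "(nat \<Rightarrow> real) \<Rightarrow> (nat \<Rightarrow> code)"
  assumes "n \<ge> 1"
    and "a \<in> carrier D_inf" and "b \<in> carrier D_inf"
    and "npath (scott_topology D_inf) n a b p" and "npath (scott_topology D_inf) n a b q"
    and "parallel (scott_topology D_inf) n a b p q"
  shows "npath_homotopic (scott_topology D_inf) n a b p q"
  by (rule npath_homotopic_of_meets[OF cpo_D_inf c_space_D_inf D_inf_meet assms(4,5)])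

end
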